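(* Let $\mathcal{H}$ be a real Hilbert space, let $S:\mathcal{H}\to 2^{\mathcal{H}}$ be maximal monotone, let $T:\mathcal{H}\to\mathcal{H}$ be monotone and Lipschitz continuous with constant $\mathsf{L}>0$, and assume that $(S+T)^{-1}(0)$ is nonempty. Let $U:\mathcal{H}\to\mathcal{H}$ be a contraction with constant $\bar{\kappa}\in[0,\frac12)$. Let $\delta_0,\delta_1>0$, $\bar{\vartheta}\in[0,1)$, $\bar{\beta}\in(0,\frac14)$, $\bar{r}\in\left(\bar{\beta},\frac{1-2\bar{\beta}}{2}\right)$, let $\{\sigma_n\}_{n\ge1}$ be a sequence in $(0,1)$ and $\{c_n\}_{n\ge1}$ a sequence in $[0,\infty)$ with $\sum_{n=1}^\infty c_n<\infty$. For arbitrary $w_0,w_1\in\mathcal{H}$, let $\{w_n\}$ be generated by $$w_{n+1}=J^{S}_{\delta_n}\big(\sigma_nUw_n+(1-\sigma_n)(w_n+\bar{\vartheta}(w_n-w_{n-1}))-\delta_nTw_n-\delta_{n-1}(1-\sigma_n(1-2\bar{\kappa}))(Tw_n-Tw_{n-1})\big),\quad n\ge1,$$ where, for $n\ge 1$, $$\delta_{n+1}=\begin{cases}\min\left\{\dfrac{\bar{r}\|w_n-w_{n+1}\|}{\|Tw_n-Tw_{n+1}\|},\ \delta_n+c_n\right\},&\text{if }Tw_n\ne Tw_{n+1},\\ \delta_n+c_n,&\text{otherwise.}\end{cases}$$ If $0\le\bar{\vartheta}<\min\left\{\frac{\bar{\beta}}{2},\frac{\frac12-\bar{r}}{2}\right\}$,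 $\lim_{n\to\infty}\sigma_n=0$ and $\sum_{n=1}^\infty\sigma_n=\infty$, then $\{w_n\}$ converges strongly (i.e., in norm) to the point $\widehat{w}\in\mathcal{H}$ satisfying $\widehat{w}=P_{(S+T)^{-1}(0)}U\widehat{w}$.
   Context: $(S+T)^{-1}(0)=\{w\in\mathcal{H}: 0\in Sw+Tw\}$. For $\delta>0$, $J^S_\delta=(I_{\mathcal{H}}+\delta S)^{-1}$ is the resolvent of $S$, which is single-valued and everywhere defined when $S$ is maximal monotone. A set-valued operator $S$ is monotone if $\langle \hat a-\hat b,a-b\rangle\ge0$ for all $a,b\in\mathcal{H}$, $\hat a\in Sa$, $\hat b\in Sb$, and maximal monotone if, in addition, its graph is not properly contained in the graph of any other monotone operator. $T$ is monotone if $\langle Ta-Tb,a-b\rangle\ge0$ for all $a,b$, and Lipschitz continuous with constant $\mathsf{L}$ if $\|Ta-Tb\|\le\mathsf{L}\|a-b\|$ for all $a,b$. $U$ is a contraction with constant $\bar\kappa$ if $\|Ua-Ub\|\le\bar\kappa\|a-b\|$ for all $a,b\in\mathcal{H}$. $P_C$ denotes the metric projection onto a nonempty closed convex set $C\subseteq\mathcal{H}$ (the set $(S+T)^{-1}(0)$ is closed and convex because $S+T$ is maximal monotone). Since $P_{(S+T)^{-1}(0)}\circ U$ is a contraction with constant less than $1$, it has a unique fixed point. *)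

theory Defs
  imports "HOL-Analysis.Analysis"
begin

text \<open>A real Hilbert space is a type of sort \<open>{real_inner, complete_space}\<close>; a set-valued
  operator on it is a function into sets, with empty values allowed.\<close>

definition op_graph :: "('a \<Rightarrow> 'a set) \<Rightarrow> ('a \<times> 'a) set" where
  "op_graph S = {(a, u). u \<in> S a}"

definition monotone_operator :: "('a::real_inner \<Rightarrow> 'a set) \<Rightarrow> bool" where
  "monotone_operator S \<longleftrightarrow> (\<forall>a b. \<forall>u\<in>S a. \<forall>v\<in>S b. (u - v) \<bullet> (a - b) \<ge> 0)"

definition maximal_monotone :: "('a::real_inner \<Rightarrow> 'a set) \<Rightarrow> bool" where
  "maximal_monotone S \<longleftrightarrow>
     monotone_operator S \<and> \<not> (\<exists>S'. monotone_operator S' \<and> op_graph S \<subset> op_graph S')"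

definition zeros_of_sum :: "('a::real_vector \<Rightarrow> 'a set) \<Rightarrow> ('a \<Rightarrow> 'a) \<Rightarrow> 'a set" where
  "zeros_of_sum S T = {w. 0 \<in> (\<lambda>u. u + T w) ` S w}"

text \<open>\<open>resolvent S \<delta> x\<close> is the point \<open>z\<close> with \<open>x \<in> z + \<delta> S z\<close>. It exists and is unique when
  \<open>S\<close> is maximal monotone and \<open>\<delta> > 0\<close> (Minty); otherwise the value may be unspecified.\<close>

definition resolvent :: "('a::real_vector \<Rightarrow> 'a set) \<Rightarrow> real \<Rightarrow> 'a \<Rightarrow> 'a" where
  "resolvent S \<delta> x = (THE z. x \<in> (\<lambda>u. z + \<delta> *\<^sub>R u) ` S z)"

text \<open>The library's \<open>closest_point\<close> is restricted to the sort \<open>heine_borel\<close>, which excludes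
  infinite-dimensional Hilbert spaces.\<close>

definition metric_projection :: "'a::metric_space set \<Rightarrow> 'a \<Rightarrow> 'a" where
  "metric_projection C x = (THE p. p \<in> C \<and> (\<forall>q\<in>C. dist x p \<le> dist x q))"

end

theory Submission
  imports Defs
begin

text \<open>Write \<open>A = S + T\<close>, \<open>\<omega>\<close> for the fixed point, \<open>a\<^sub>n = |w\<^sub>n - \<omega>|\<^sup>2\<close>,
  \<open>D\<^sub>n = |w\<^sub>n - w\<^sub>n\<^sub>-\<^sub>1|\<close> and \<open>s\<^sub>n = \<sigma>\<^sub>n (1 - 2\<kappa>)\<close>. Monotonicity of \<open>S\<close> and \<open>T\<close> shows that
  \<open>\<Phi>\<^sub>n = a\<^sub>n - 2 \<delta>\<^sub>n\<^sub>-\<^sub>1 (T w\<^sub>n - T w\<^sub>n\<^sub>-\<^sub>1) \<bullet> (w\<^sub>n - \<omega>) - \<theta> a\<^sub>n\<^sub>-\<^sub>1 + D\<^sub>n\<^sup>2 / 2\<close> dominates \<open>a\<^sub>n / 2\<close> and satisfies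
  \<open>\<Phi>\<^sub>n\<^sub>+\<^sub>1 \<le> (1 - s\<^sub>n) \<Phi>\<^sub>n + 2 \<sigma>\<^sub>n b\<^sub>n\<^sub>+\<^sub>1 - \<epsilon> (D\<^sub>n\<^sup>2 + D\<^sub>n\<^sub>+\<^sub>1\<^sup>2)\<close> for large \<open>n\<close>, where
  \<open>b\<^sub>n = (U \<omega> - \<omega>) \<bullet> (w\<^sub>n - \<omega>)\<close>; hence the iterates are bounded.
  The point \<open>\<omega>\<close> is the strong limit of the resolvents \<open>(I + \<lambda>A)\<^sup>-\<^sup>1 (U \<omega>)\<close> as \<open>\<lambda> \<rightarrow> \<infinity>\<close>. Comparing \<open>w\<^sub>n\<^sub>+\<^sub>1\<close> with
  such a resolvent gives \<open>b\<^sub>n\<^sub>+\<^sub>1 \<le> \<eta> + K (\<sigma>\<^sub>n + D\<^sub>n + D\<^sub>n\<^sub>+\<^sub>1)\<close> with \<open>K\<close> depending on \<open>\<eta>\<close>, and by Young's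
  inequality the negative term absorbs the increments because \<open>\<sigma>\<^sub>n \<rightarrow> 0\<close>. So eventually
  \<open>\<Phi>\<^sub>n\<^sub>+\<^sub>1 \<le> (1 - s\<^sub>n) \<Phi>\<^sub>n + 3 \<sigma>\<^sub>n \<eta>\<close> for every \<open>\<eta> > 0\<close>, and \<open>\<Phi>\<^sub>n \<rightarrow> 0\<close> since \<open>\<Sum>\<sigma>\<^sub>n = \<infinity>\<close>. Weak compactness
  is not needed anywhere.\<close>

subsection \<open>Maximal monotone operators\<close>

text \<open>A sandwich theorem: the conclusion unfolds to
  \<open>(norm z)\<^sup>2 - 2 * (x \<bullet> z) \<le> s\<close>, so an affine function separates the
  concave \<open>- (norm x)\<^sup>2\<close> from \<open>K\<close>. The point \<open>z\<close> is the
  limit of the first components of a minimizing sequence of \<open>\<psi>\<close>, which is strongly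
  convex in that component.\<close>

lemma convex_quadratic_support:
  fixes K :: "('a::{real_inner,complete_space} \<times> real) set"
  assumes K: "convex K" and pos: "\<And>x s. (x, s) \<in> K \<Longrightarrow> 0 \<le> (norm x)\<^sup>2 + s"
  shows "\<exists>z. \<forall>(x, s)\<in>K. (norm (x - z))\<^sup>2 \<le> (norm x)\<^sup>2 + s"
proof (cases "K = {}")
  case False
  define \<psi> :: "'a \<times> real \<Rightarrow> real" where "\<psi> = (\<lambda>k. (norm (fst k))\<^sup>2 + snd k)"
  define m where "m = Inf (\<psi> ` K)"
  have bdd: "bdd_below (\<psi> ` K)"
    using pos by (intro bdd_belowI[of _ 0]) (auto simp: \<psi>_def)
  have m_le: "m \<le> \<psi> k" if "k \<in> K" for k
    unfolding m_def using bdd that by (simp add: cINF_lower)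
  have m_nonneg: "0 \<le> m"
    unfolding m_def using False pos by (intro cINF_greatest) (auto simp: \<psi>_def)
  have "\<exists>k\<in>K. \<psi> k < m + inverse (real (Suc i))" for i
    using cInf_lessD[of "\<psi> ` K" "m + inverse (real (Suc i))"] False unfolding m_def by force
  then obtain k where kK: "\<And>i. k i \<in> K" and k_less: "\<And>i. \<psi> (k i) < m + inverse (real (Suc i))"
    by metis
  have comb: "\<psi> ((1 - t) *\<^sub>R k1 + t *\<^sub>R k2)
      = (1 - t) * \<psi> k1 + t * \<psi> k2 - t * (1 - t) * (norm (fst k1 - fst k2))\<^sup>2" for t k1 k2
    by (simp add: \<psi>_def power2_norm_eq_inner inner_simps inner_commute algebra_simps)
  have m_comb: "m \<le> (1 - t) * \<psi> k1 + t * \<psi> k2 - t * (1 - t) * (norm (fst k1 - fst k2))\<^sup>2"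
    if "k1 \<in> K" "k2 \<in> K" "0 \<le> t" "t \<le> 1" for t k1 k2
    using m_le[of "(1 - t) *\<^sub>R k1 + t *\<^sub>R k2"] K that unfolding comb convex_alt by blast
  have k_lim: "(\<lambda>i. \<psi> (k i)) \<longlonglongrightarrow> m"
  proof (rule tendsto_sandwich[where f = "\<lambda>_. m" and h = "\<lambda>i. m + inverse (real (Suc i))"])
    show "(\<lambda>i. m + inverse (real (Suc i))) \<longlonglongrightarrow> m"
      using tendsto_add[OF tendsto_const[of m] LIMSEQ_inverse_real_of_nat] by simp
  qed (use m_le kK k_less in \<open>auto intro!: always_eventually less_imp_le\<close>)
  have "Cauchy (\<lambda>i. fst (k i))"
  proof (rule metric_CauchyI)
    fix e :: real assume "e > 0"
    then have "eventually (\<lambda>i. \<psi> (k i) < m + e\<^sup>2 / 4) sequentially"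
      by (intro order_tendstoD[OF k_lim]) simp
    then obtain N where N: "\<And>i. i \<ge> N \<Longrightarrow> \<psi> (k i) < m + e\<^sup>2 / 4"
      by (auto simp: eventually_sequentially)
    have "dist (fst (k i)) (fst (k j)) < e" if "i \<ge> N" "j \<ge> N" for i j
    proof -
      have "(norm (fst (k i) - fst (k j)))\<^sup>2 < e\<^sup>2"
        using m_comb[OF kK[of i] kK[of j], of "1/2"] N[OF that(1)] N[OF that(2)] by simp
      then show ?thesis
        unfolding dist_norm by (rule power2_less_imp_less) (use \<open>e > 0\<close> in simp)
    qed
    then show "\<exists>M. \<forall>i\<ge>M. \<forall>j\<ge>M. dist (fst (k i)) (fst (k j)) < e" by blast
  qed
  then obtain z where z: "(\<lambda>i. fst (k i)) \<longlonglongrightarrow> z"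
    using Cauchy_convergent_iff convergent_def by blast
  have "(norm (x - z))\<^sup>2 \<le> (norm x)\<^sup>2 + s" if xs: "(x, s) \<in> K" for x s
  proof -
    \<comment> \<open>Convexity on the segment from \<open>k i\<close> to \<open>(x, s)\<close>:
      \<open>i\<close> goes to infinity, one factor \<open>t\<close> is cancelled, and only then
      \<open>t\<close> tends to 0.\<close>
    have t: "m \<le> \<psi> (x, s) - (1 - t) * (norm (z - x))\<^sup>2" if "0 < t" "t \<le> 1" for t
    proof -
      have "(\<lambda>i. (1 - t) * \<psi> (k i) + t * \<psi> (x, s) - t * (1 - t) * (norm (fst (k i) - x))\<^sup>2)
          \<longlonglongrightarrow> (1 - t) * m + t * \<psi> (x, s) - t * (1 - t) * (norm (z - x))\<^sup>2"
        by (intro tendsto_intros k_lim z)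
      then have "m \<le> (1 - t) * m + t * \<psi> (x, s) - t * (1 - t) * (norm (z - x))\<^sup>2"
        by (rule LIMSEQ_le_const) (use m_comb[OF kK xs, of t] that in auto)
      then have "t * m \<le> t * (\<psi> (x, s) - (1 - t) * (norm (z - x))\<^sup>2)"
        by (simp add: algebra_simps)
      then show ?thesis using \<open>0 < t\<close> by simp
    qed
    have "(\<lambda>i. \<psi> (x, s) - (1 - inverse (real (Suc i))) * (norm (z - x))\<^sup>2)
        \<longlonglongrightarrow> \<psi> (x, s) - (1 - 0) * (norm (z - x))\<^sup>2"
      by (intro tendsto_intros LIMSEQ_inverse_real_of_nat)
    then have "m \<le> \<psi> (x, s) - (1 - 0) * (norm (z - x))\<^sup>2"
      by (rule LIMSEQ_le_const) (use t[of "inverse (real (Suc _))"] in \<open>auto simp: field_simps\<close>)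
    then show ?thesis
      using m_nonneg by (simp add: \<psi>_def norm_minus_commute)
  qed
  then show ?thesis by blast
qed simp

text \<open>The conclusion says that \<open>(z, -z)\<close> is monotonically related to \<open>G\<close>.\<close>

lemma monotone_set_extension:
  fixes G :: "('a::{real_inner,complete_space} \<times> 'a) set"
  assumes mono: "\<And>a u b v. (a, u) \<in> G \<Longrightarrow> (b, v) \<in> G \<Longrightarrow> 0 \<le> (u - v) \<bullet> (a - b)"
  shows "\<exists>z. \<forall>(a, u)\<in>G. 0 \<le> (u + z) \<bullet> (a - z)"
proof -
  \<comment> \<open>Lifting each pair by its pairing \<open>a \<bullet> u\<close> makes monotonicity
    linear in the hull point (\<open>K1\<close>), as with the Fitzpatrick function. The map
    \<open>h\<close> halves \<open>x - y\<close> because \<open>x \<bullet> y\<close> plus the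
    square of \<open>(x - y) / 2\<close> is the square of \<open>(x + y) / 2\<close>.\<close>
  define K where "K = convex hull ((\<lambda>(a, u). (a, u, a \<bullet> u)) ` G)"
  define h :: "'a \<times> 'a \<times> real \<Rightarrow> 'a \<times> real" where "h = (\<lambda>(x, y, s). ((1/2) *\<^sub>R (x - y), s))"
  have half: "convex {(x, y, s). 0 \<le> s - x \<bullet> u - a \<bullet> y + d}" for a u :: 'a and d :: real
    unfolding convex_alt
  proof clarsimp
    fix x y s x' y' s' and t :: real
    assume "0 \<le> s - x \<bullet> u - a \<bullet> y + d" "0 \<le> s' - x' \<bullet> u - a \<bullet> y' + d" "0 \<le> t" "t \<le> 1"
    then have "0 \<le> (1 - t) * (s - x \<bullet> u - a \<bullet> y + d) + t * (s' - x' \<bullet> u - a \<bullet> y' + d)"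
      by simp
    then show "0 \<le> (1 - t) * s + t * s' - ((1 - t) *\<^sub>R x + t *\<^sub>R x') \<bullet> u
        - a \<bullet> ((1 - t) *\<^sub>R y + t *\<^sub>R y') + d"
      by (simp add: inner_simps algebra_simps)
  qed
  have K1: "0 \<le> s - x \<bullet> u - a \<bullet> y + a \<bullet> u" if "(a, u) \<in> G" "(x, y, s) \<in> K" for a u x y s
  proof -
    have "K \<subseteq> {(x, y, s). 0 \<le> s - x \<bullet> u - a \<bullet> y + a \<bullet> u}"
      unfolding K_def using mono[OF _ that(1)]
      by (intro hull_minimal half) (auto simp: inner_simps inner_commute algebra_simps)
    then show ?thesis using that(2) by blast
  qed
  \<comment> \<open>The hull argument is run a second time: by \<open>K1\<close> the half-space
    given by \<open>(x, y, s)\<close> contains all generators, hence \<open>K\<close>; at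
    \<open>(x, y, s)\<close> itself it reads \<open>0 \<le> 2 * (s - x \<bullet> y)\<close>.\<close>
  have K2: "x \<bullet> y \<le> s" if xys: "(x, y, s) \<in> K" for x y s
  proof -
    have "K \<subseteq> {(x', y', s'). 0 \<le> s' - x' \<bullet> y - x \<bullet> y' + s}"
      unfolding K_def using K1[OF _ xys]
      by (intro hull_minimal half) (fastforce simp: inner_commute algebra_simps)
    then show ?thesis using xys by auto
  qed
  have "linear h"
    by (rule linearI) (auto simp: h_def scaleR_right_distrib scaleR_right_diff_distrib)
  then have "convex (h ` K)"
    unfolding K_def by (rule convex_linear_image) (rule convex_convex_hull)
  moreover have "0 \<le> (norm x)\<^sup>2 + s" if xs: "(x, s) \<in> h ` K" for x s
  proof -
    obtain k where "k \<in> K" "h k = (x, s)"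
      using xs by auto
    then obtain a u where au: "(a, u, s) \<in> K" "x = (1/2) *\<^sub>R (a - u)"
      by (cases k) (auto simp: h_def)
    have "0 \<le> (norm (a + u))\<^sup>2 / 4" by simp
    also have "\<dots> = (norm x)\<^sup>2 + a \<bullet> u"
      unfolding au power2_norm_eq_inner by (simp add: inner_simps inner_commute field_simps)
    finally show ?thesis using K2[OF au(1)] by simp
  qed
  ultimately obtain z where z: "\<And>x s. (x, s) \<in> h ` K \<Longrightarrow> (norm (x - z))\<^sup>2 \<le> (norm x)\<^sup>2 + s"
    using convex_quadratic_support[of "h ` K"] by blast
  have "0 \<le> (u + z) \<bullet> (a - z)" if "(a, u) \<in> G" for a u
  proof -
    have "(a, u, a \<bullet> u) \<in> K"
      unfolding K_def using that by (intro hull_inc) force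
    then have "((1/2) *\<^sub>R (a - u), a \<bullet> u) \<in> h ` K"
      by (force simp: h_def)
    from z[OF this] show ?thesis
      by (simp add: power2_norm_eq_inner inner_simps inner_commute algebra_simps)
  qed
  then show ?thesis by blast
qed

lemma monotone_operatorD:
  "monotone_operator A \<Longrightarrow> u \<in> A a \<Longrightarrow> v \<in> A b \<Longrightarrow> 0 \<le> (u - v) \<bullet> (a - b)"
  by (simp add: monotone_operator_def)

text \<open>Otherwise adding \<open>(z, v)\<close> to the graph would give a strictly larger
  monotone operator.\<close>

lemma maximal_monotone_memI:
  assumes A: "maximal_monotone A" and rel: "\<And>a u. u \<in> A a \<Longrightarrow> 0 \<le> (u - v) \<bullet> (a - z)"
  shows "v \<in> A z"
proof (rule ccontr)
  assume v: "v \<notin> A z"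
  have "monotone_operator (A(z := insert v (A z)))"
    unfolding monotone_operator_def
  proof (intro allI ballI)
    fix a b u u' assume "u \<in> (A(z := insert v (A z))) a" "u' \<in> (A(z := insert v (A z))) b"
    then consider "u \<in> A a" "u' \<in> A b" | "u = v" "a = z" "u' \<in> A b" | "u \<in> A a" "u' = v" "b = z"
      | "a = b"
      by (auto split: if_splits)
    then show "0 \<le> (u - u') \<bullet> (a - b)"
    proof cases
      case 1
      then show ?thesis using A by (auto simp: maximal_monotone_def monotone_operator_def)
    next
      case 2
      then show ?thesis using rel[of u' b] by (simp add: inner_simps)
    qed (use rel in auto)
  qed
  moreover have "op_graph A \<subset> op_graph (A(z := insert v (A z)))"
    using v by (auto simp: op_graph_def split: if_splits)
  ultimately show False using A by (auto simp: maximal_monotone_def)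
qed

text \<open>The pairs \<open>(a, \<delta> *\<^sub>R u - x)\<close> form a monotone set. The
  extension point \<open>z\<close> makes \<open>(1 / \<delta>) *\<^sub>R (x - z)\<close>
  monotonically related to \<open>A\<close> at \<open>z\<close>, so maximality puts it into
  \<open>A z\<close>.\<close>

lemma minty_surjectivity:
  fixes A :: "'a::{real_inner,complete_space} \<Rightarrow> 'a set"
  assumes A: "maximal_monotone A" and \<delta>: "\<delta> > 0"
  shows "\<exists>z. \<exists>u\<in>A z. z + \<delta> *\<^sub>R u = x"
proof -
  have mono: "monotone_operator A" using A by (simp add: maximal_monotone_def)
  have "\<exists>z. \<forall>(a, u)\<in>{(a, \<delta> *\<^sub>R u - x) | a u. u \<in> A a}. 0 \<le> (u + z) \<bullet> (a - z)"
  proof (rule monotone_set_extension, clarsimp)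
    fix a b u v assume "u \<in> A a" "v \<in> A b"
    then have "0 \<le> \<delta> * ((u - v) \<bullet> (a - b))"
      using monotone_operatorD[OF mono] \<delta> by simp
    then show "0 \<le> (\<delta> *\<^sub>R u - \<delta> *\<^sub>R v) \<bullet> (a - b)"
      by (simp add: inner_simps algebra_simps)
  qed
  then obtain z where z: "\<And>a u. u \<in> A a \<Longrightarrow> 0 \<le> (\<delta> *\<^sub>R u - x + z) \<bullet> (a - z)"
    by fastforce
  have "(1 / \<delta>) *\<^sub>R (x - z) \<in> A z"
  proof (rule maximal_monotone_memI[OF A])
    fix a u assume "u \<in> A a"
    from z[OF this] have "0 \<le> (\<delta> *\<^sub>R (u - (1 / \<delta>) *\<^sub>R (x - z))) \<bullet> (a - z)"
      using \<delta> by (simp add: algebra_simps)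
    then show "0 \<le> (u - (1 / \<delta>) *\<^sub>R (x - z)) \<bullet> (a - z)"
      using \<delta> by (simp add: zero_le_mult_iff)
  qed
  then show ?thesis
    using \<delta> by (intro exI[of _ z] bexI[of _ "(1 / \<delta>) *\<^sub>R (x - z)"]) auto
qed

text \<open>In the expanded square the cross term is a nonnegative pairing. This is also the source
  of uniqueness: equal images force \<open>a = b\<close>.\<close>

lemma monotone_resolvent_nonexpansive:
  assumes A: "monotone_operator A" and \<delta>: "\<delta> > 0" and u: "u \<in> A a" and v: "v \<in> A b"
  shows "norm (a - b) \<le> norm ((a + \<delta> *\<^sub>R u) - (b + \<delta> *\<^sub>R v))"
proof (rule power2_le_imp_le)
  have "0 \<le> \<delta> * ((u - v) \<bullet> (a - b))"
    using monotone_operatorD[OF A u v] \<delta> by simp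
  moreover have "(norm ((a + \<delta> *\<^sub>R u) - (b + \<delta> *\<^sub>R v)))\<^sup>2
      = (norm (a - b))\<^sup>2 + 2 * (\<delta> * ((u - v) \<bullet> (a - b))) + (norm (\<delta> *\<^sub>R (u - v)))\<^sup>2"
    by (simp add: power2_norm_eq_inner inner_simps inner_commute algebra_simps)
  ultimately show "(norm (a - b))\<^sup>2 \<le> (norm ((a + \<delta> *\<^sub>R u) - (b + \<delta> *\<^sub>R v)))\<^sup>2"
    by (smt (verit) zero_le_power2)
qed simp

lemma resolvent_mem:
  fixes A :: "'a::{real_inner,complete_space} \<Rightarrow> 'a set"
  assumes A: "maximal_monotone A" and \<delta>: "\<delta> > 0"
  shows "\<exists>u\<in>A (resolvent A \<delta> x). resolvent A \<delta> x + \<delta> *\<^sub>R u = x"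
proof -
  have mono: "monotone_operator A" using A by (simp add: maximal_monotone_def)
  obtain z u where z: "u \<in> A z" "z + \<delta> *\<^sub>R u = x"
    using minty_surjectivity[OF A \<delta>] by blast
  have "x \<in> (\<lambda>u. resolvent A \<delta> x + \<delta> *\<^sub>R u) ` A (resolvent A \<delta> x)"
    unfolding resolvent_def
  proof (rule theI)
    show "x \<in> (\<lambda>u. z + \<delta> *\<^sub>R u) ` A z" using z by blast
    fix y assume "x \<in> (\<lambda>u. y + \<delta> *\<^sub>R u) ` A y"
    then obtain v where v: "v \<in> A y" "y + \<delta> *\<^sub>R v = x" by auto
    show "y = z"
      using monotone_resolvent_nonexpansive[OF mono \<delta> v(1) z(1)] v(2) z(2) by simp
  qed
  then obtain u where "x = resolvent A \<delta> x + \<delta> *\<^sub>R u" and u: "u \<in> A (resolvent A \<delta> x)"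
    by (rule imageE)
  from this(1) have "resolvent A \<delta> x + \<delta> *\<^sub>R u = x" by (rule sym)
  then show ?thesis using u by (rule bexI)
qed

text \<open>Converse of Minty's theorem: if \<open>I + \<delta> A\<close> is onto, every pair of a
  monotone extension shares its image with a pair of \<open>A\<close> and so equals it. Surjectivity
  comes from the Banach fixed point of \<open>z \<mapsto> resolvent S \<delta> (x - \<delta>
  *\<^sub>R T z)\<close>, a contraction since \<open>\<delta> * L < 1\<close>.\<close>

lemma maximal_monotone_add_lipschitz:
  fixes S :: "'a::{real_inner,complete_space} \<Rightarrow> 'a set"
  assumes S: "maximal_monotone S" and T_mono: "\<And>a b. 0 \<le> (T a - T b) \<bullet> (a - b)"
    and lip: "L-lipschitz_on UNIV T"
  shows "maximal_monotone (\<lambda>w. (\<lambda>u. u + T w) ` S w)" (is "maximal_monotone ?A")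
proof -
  have S_mono: "monotone_operator S" using S by (simp add: maximal_monotone_def)
  have A_mono: "monotone_operator ?A"
    unfolding monotone_operator_def
  proof clarify
    fix a b u v assume "u \<in> S a" "v \<in> S b"
    then show "0 \<le> (u + T a - (v + T b)) \<bullet> (a - b)"
      using monotone_operatorD[OF S_mono, of u a v b] T_mono[of a b] by (simp add: inner_simps)
  qed
  define \<delta> where "\<delta> = 1 / (2 * (L + 1))"
  have L: "0 \<le> L" using lipschitz_on_nonneg[OF lip] .
  then have \<delta>: "\<delta> > 0" "\<delta> * L < 1" by (auto simp: \<delta>_def field_simps)
  have surj: "\<exists>z. \<exists>u\<in>?A z. z + \<delta> *\<^sub>R u = x" for x
  proof -
    have "dist (resolvent S \<delta> (x - \<delta> *\<^sub>R T a)) (resolvent S \<delta> (x - \<delta> *\<^sub>R T b)) \<le> \<delta> * L * dist a b"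
      for a b
    proof -
      have "norm (resolvent S \<delta> (x - \<delta> *\<^sub>R T a) - resolvent S \<delta> (x - \<delta> *\<^sub>R T b))
          \<le> norm ((x - \<delta> *\<^sub>R T a) - (x - \<delta> *\<^sub>R T b))"
        using resolvent_mem[OF S \<delta>(1), of "x - \<delta> *\<^sub>R T a"]
          resolvent_mem[OF S \<delta>(1), of "x - \<delta> *\<^sub>R T b"]
          monotone_resolvent_nonexpansive[OF S_mono \<delta>(1)] by metis
      also have "\<dots> = \<delta> * dist (T a) (T b)"
        using \<delta>(1) by (simp add: dist_norm norm_minus_commute flip: scaleR_diff_right)
      also have "\<dots> \<le> \<delta> * (L * dist a b)"
        using \<delta>(1) lipschitz_onD[OF lip, of a b] by simp
      finally show ?thesis by (simp add: dist_norm)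
    qed
    then have "\<exists>!z. resolvent S \<delta> (x - \<delta> *\<^sub>R T z) = z"
      using \<delta> L by (intro banach_fix_type[where c = "\<delta> * L"]) auto
    then obtain z where "resolvent S \<delta> (x - \<delta> *\<^sub>R T z) = z" by blast
    with resolvent_mem[OF S \<delta>(1), of "x - \<delta> *\<^sub>R T z"]
    obtain u where "u \<in> S z" "z + \<delta> *\<^sub>R u = x - \<delta> *\<^sub>R T z" by auto
    then have "u + T z \<in> ?A z" "z + \<delta> *\<^sub>R (u + T z) = x"
      by (auto simp: algebra_simps)
    then show ?thesis by blast
  qed
  show ?thesis
    unfolding maximal_monotone_def
  proof (intro conjI A_mono notI, elim exE conjE)
    fix B assume B: "monotone_operator B" and sub: "op_graph ?A \<subset> op_graph B"
    then obtain z v where v: "v \<in> B z" "v \<notin> ?A z"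
      by (auto simp: op_graph_def)
    obtain a u where u: "u \<in> ?A a" "a + \<delta> *\<^sub>R u = z + \<delta> *\<^sub>R v"
      using surj by blast
    then have "u \<in> B a" using sub by (auto simp: op_graph_def)
    then have "a = z"
      using monotone_resolvent_nonexpansive[OF B \<delta>(1) _ v(1), of u a] u(2) by simp
    with u v \<delta> show False by auto
  qed
qed

text \<open>The variational inequality gives a Pythagorean inequality at \<open>p\<close>, which
  yields both the minimality and the uniqueness demanded by the definite description.\<close>

lemma metric_projectionI:
  fixes C :: "'a::real_inner set"
  assumes p: "p \<in> C" and var: "\<And>q. q \<in> C \<Longrightarrow> (x - p) \<bullet> (q - p) \<le> 0"
  shows "metric_projection C x = p"
  unfolding metric_projection_def
proof (rule the_equality)
  have le: "(norm (x - p))\<^sup>2 + (norm (p - q))\<^sup>2 \<le> (norm (x - q))\<^sup>2" if "q \<in> C" for q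
    using var[OF that] by (simp add: power2_norm_eq_inner inner_simps inner_commute algebra_simps)
  have "dist x p \<le> dist x q" if "q \<in> C" for q
    using le[OF that] unfolding dist_norm by (smt (verit) power2_le_imp_le zero_le_power2 norm_ge_zero)
  then show "p \<in> C \<and> (\<forall>q\<in>C. dist x p \<le> dist x q)" using p by blast
  fix q assume q: "q \<in> C \<and> (\<forall>q'\<in>C. dist x q \<le> dist x q')"
  then have "(norm (x - q))\<^sup>2 \<le> (norm (x - p))\<^sup>2"
    using p by (simp add: dist_norm power_mono)
  moreover have "(norm (x - p))\<^sup>2 + (norm (p - q))\<^sup>2 \<le> (norm (x - q))\<^sup>2"
    using le q by blast
  ultimately have "(norm (p - q))\<^sup>2 \<le> 0" by linarith
  then show "q = p" by simp
qed

text \<open>Along increasing parameters the resolvents at \<open>x\<close> satisfy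
  \<open>|u\<^sub>i - x|\<^sup>2 + |u\<^sub>j - u\<^sub>i|\<^sup>2 \<le> |u\<^sub>j - x|\<^sup>2\<close>, which makes them Cauchy without any weak
  compactness.\<close>

lemma resolvent_tendsto_zero:
  fixes A :: "'a::{real_inner,complete_space} \<Rightarrow> 'a set"
  assumes A: "maximal_monotone A" and q: "0 \<in> A q"
  obtains u p where "\<And>k. (1 / real (Suc k)) *\<^sub>R (x - u k) \<in> A (u k)" "u \<longlonglongrightarrow> p" "0 \<in> A p"
    "\<And>q. 0 \<in> A q \<Longrightarrow> (x - p) \<bullet> (q - p) \<le> 0"
proof -
  have mono: "monotone_operator A" using A by (simp add: maximal_monotone_def)
  have "\<exists>z. (1 / real (Suc k)) *\<^sub>R (x - z) \<in> A z" for k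
  proof -
    obtain z v where v: "v \<in> A z" "z + real (Suc k) *\<^sub>R v = x"
      using minty_surjectivity[OF A, of "real (Suc k)" x] by auto
    have "(1 / real (Suc k)) *\<^sub>R (x - z) = v"
      using v(2) by (metis add_diff_cancel_left' divide_self_if nat.simps(3) of_nat_eq_0_iff
          scaleR_one scaleR_scaleR times_divide_eq_left mult_1)
    with v show ?thesis by metis
  qed
  then obtain u where u: "\<And>k. (1 / real (Suc k)) *\<^sub>R (x - u k) \<in> A (u k)" by metis
  have var: "0 \<le> (x - u k) \<bullet> (u k - q)" if "0 \<in> A q" for k q
    using monotone_operatorD[OF mono u[of k] that] by (simp add: zero_le_mult_iff zero_le_divide_iff)
  define y where "y k = (norm (u k - x))\<^sup>2" for k
  have pyth: "y i + (norm (u j - u i))\<^sup>2 \<le> y j" if "i \<le> j" for i j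
  proof (cases "i = j")
    case False
    define a b where "a = 1 / real (Suc j)" and "b = 1 / real (Suc i)"
    have ab: "0 < a" "a < b"
      using that False by (auto simp: a_def b_def divide_simps)
    have "0 \<le> (a *\<^sub>R (x - u j) - b *\<^sub>R (x - u i)) \<bullet> (u j - u i)"
      unfolding a_def b_def by (rule monotone_operatorD[OF mono u u])
    \<comment> \<open>The left vector equals
      \<open>(b - a) *\<^sub>R (u i - x) - a *\<^sub>R (u j - u i)\<close>; since
      \<open>a < b\<close>, monotonicity fixes the sign of the cross term.\<close>
    also have "\<dots> = (b - a) * ((u i - x) \<bullet> (u j - u i)) - a * (norm (u j - u i))\<^sup>2"
      by (simp add: power2_norm_eq_inner inner_simps inner_commute algebra_simps)
    finally have "0 \<le> (b - a) * ((u i - x) \<bullet> (u j - u i))"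
      using ab by (smt (verit) mult_nonneg_nonneg zero_le_power2)
    then have "0 \<le> (u i - x) \<bullet> (u j - u i)"
      using ab by (simp add: zero_le_mult_iff)
    then show ?thesis
      by (simp add: y_def power2_norm_eq_inner inner_simps inner_commute algebra_simps)
  qed simp
  have "incseq y"
    by (rule monoI) (use pyth in \<open>smt (verit) zero_le_power2\<close>)
  moreover have "y k \<le> (norm (q - x))\<^sup>2" for k
  proof -
    have "(norm (q - x))\<^sup>2 = y k + (norm (u k - q))\<^sup>2 + 2 * ((x - u k) \<bullet> (u k - q))"
      by (simp add: y_def power2_norm_eq_inner inner_simps inner_commute algebra_simps)
    then show ?thesis using var[OF q, of k] by (smt (verit) zero_le_power2)
  qed
  ultimately obtain l where l: "y \<longlonglongrightarrow> l" "\<And>k. y k \<le> l"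
    using incseq_convergent[of y "(norm (q - x))\<^sup>2"] by metis
  have "Cauchy u"
  proof (rule metric_CauchyI)
    fix e :: real assume e: "e > 0"
    then have "eventually (\<lambda>i. l - (e/2)\<^sup>2 < y i) sequentially"
      by (intro order_tendstoD[OF l(1)]) simp
    then obtain N where N: "\<And>i. i \<ge> N \<Longrightarrow> l - (e/2)\<^sup>2 < y i"
      by (auto simp: eventually_sequentially)
    have near: "dist (u i) (u N) < e / 2" if "i \<ge> N" for i
    proof -
      have "(norm (u i - u N))\<^sup>2 < (e/2)\<^sup>2"
        using pyth[OF that] N[of N] l(2)[of i] by simp
      then show ?thesis
        unfolding dist_norm by (rule power2_less_imp_less) (use e in simp)
    qed
    have "dist (u i) (u j) < e" if "i \<ge> N" "j \<ge> N" for i j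
      using near[OF that(1)] near[OF that(2)] dist_triangle_half_r[of "u N" "u i" e "u j"]
      by (simp add: dist_commute)
    then show "\<exists>M. \<forall>i\<ge>M. \<forall>j\<ge>M. dist (u i) (u j) < e" by blast
  qed
  then obtain p where p: "u \<longlonglongrightarrow> p"
    using Cauchy_convergent_iff convergent_def by blast
  have inv: "(\<lambda>k. 1 / real (Suc k)) \<longlonglongrightarrow> 0"
    using LIMSEQ_inverse_real_of_nat by (simp add: inverse_eq_divide)
  \<comment> \<open>The elements \<open>(1 / real (Suc k)) *\<^sub>R (x - u k)\<close> of
    \<open>A (u k)\<close> tend to 0, and a maximal monotone graph is closed.\<close>
  have "0 \<in> A p"
  proof (rule maximal_monotone_memI[OF A])
    fix a v assume v: "v \<in> A a"
    have "(\<lambda>k. (v - (1 / real (Suc k)) *\<^sub>R (x - u k)) \<bullet> (a - u k))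
        \<longlonglongrightarrow> (v - 0 *\<^sub>R (x - p)) \<bullet> (a - p)"
      by (intro tendsto_intros inv p)
    then have "0 \<le> (v - 0 *\<^sub>R (x - p)) \<bullet> (a - p)"
      by (rule LIMSEQ_le_const) (use monotone_operatorD[OF mono v u] in blast)
    then show "0 \<le> (v - 0) \<bullet> (a - p)" by simp
  qed
  moreover have "(x - p) \<bullet> (q - p) \<le> 0" if "0 \<in> A q" for q
  proof -
    have "(\<lambda>k. (x - u k) \<bullet> (u k - q)) \<longlonglongrightarrow> (x - p) \<bullet> (p - q)"
      by (intro tendsto_intros p)
    then have "0 \<le> (x - p) \<bullet> (p - q)"
      by (rule LIMSEQ_le_const) (use var[OF that] in blast)
    then show ?thesis by (simp add: inner_diff_right)
  qed
  ultimately show ?thesis using that u p by blast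
qed

text \<open>The resolvent limits are the projections; adding their two variational inequalities and
  applying Cauchy-Schwarz gives the bound.\<close>

lemma metric_projection_zeros_nonexpansive:
  fixes A :: "'a::{real_inner,complete_space} \<Rightarrow> 'a set"
  assumes A: "maximal_monotone A" and q: "0 \<in> A q"
  shows "norm (metric_projection {w. 0 \<in> A w} x - metric_projection {w. 0 \<in> A w} y) \<le> norm (x - y)"
proof -
  obtain a b where a: "0 \<in> A a" "\<And>q. 0 \<in> A q \<Longrightarrow> (x - a) \<bullet> (q - a) \<le> 0"
    and b: "0 \<in> A b" "\<And>q. 0 \<in> A q \<Longrightarrow> (y - b) \<bullet> (q - b) \<le> 0"
    using resolvent_tendsto_zero[OF A q] by metis
  have eq: "metric_projection {w. 0 \<in> A w} x = a" "metric_projection {w. 0 \<in> A w} y = b"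
    using a b by (auto intro!: metric_projectionI)
  have "(norm (a - b))\<^sup>2 \<le> (x - y) \<bullet> (a - b)"
    using a(2)[OF b(1)] b(2)[OF a(1)]
    by (simp add: power2_norm_eq_inner inner_simps inner_commute algebra_simps)
  also have "\<dots> \<le> norm (x - y) * norm (a - b)" by (rule norm_cauchy_schwarz)
  finally have "norm (a - b) * norm (a - b) \<le> norm (x - y) * norm (a - b)"
    by (simp add: power2_eq_square)
  then show ?thesis
    unfolding eq by (cases "a = b") (simp_all add: mult_le_cancel_right)
qed

subsection \<open>Perturbed contractive recursions\<close>

text \<open>The excess over \<open>\<eta>\<close> is multiplied by
  \<open>1 - s n \<le> exp (- s n)\<close>, so it is at most a constant times the exponential of
  minus the partial sums, and these sums diverge.\<close>

lemma perturbed_contraction_eventually_less: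
  fixes \<Phi> s :: "nat \<Rightarrow> real"
  assumes s: "\<And>n. n \<ge> N \<Longrightarrow> s n \<le> 1"
    and div: "filterlim (\<lambda>n. \<Sum>k=1..n. s k) at_top sequentially"
    and rec: "\<And>n. n \<ge> N \<Longrightarrow> \<Phi> (Suc n) \<le> (1 - s n) * \<Phi> n + s n * \<eta>"
    and e: "e > 0"
  shows "eventually (\<lambda>n. \<Phi> n < \<eta> + e) sequentially"
proof -
  \<comment> \<open>The exponential undoes the terms up to \<open>N\<close>, since the sums in
    \<open>div\<close> start at 1; the absolute value keeps \<open>C\<close> nonnegative when
    \<open>\<Phi>\<close> is below \<open>\<eta>\<close>.\<close>
  define C where "C = exp (\<Sum>k=1..N. s k) * \<bar>\<Phi> (Suc N) - \<eta>\<bar>"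
  have bound: "\<Phi> (Suc (N + m)) - \<eta> \<le> exp (- (\<Sum>k=1..N + m. s k)) * C" for m
  proof (induction m)
    case 0
    then show ?case by (simp add: C_def mult.assoc[symmetric] exp_minus)
  next
    case (Suc m)
    let ?s = "s (Suc (N + m))"
    have C: "0 \<le> C" by (simp add: C_def)
    have "\<Phi> (Suc (N + Suc m)) - \<eta> \<le> (1 - ?s) * (\<Phi> (Suc (N + m)) - \<eta>)"
      using rec[of "Suc (N + m)"] by (simp add: algebra_simps)
    also have "\<dots> \<le> (1 - ?s) * (exp (- (\<Sum>k=1..N + m. s k)) * C)"
      using Suc.IH s[of "Suc (N + m)"] by (intro mult_left_mono) auto
    also have "\<dots> \<le> exp (- ?s) * (exp (- (\<Sum>k=1..N + m. s k)) * C)"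
      using exp_ge_add_one_self[of "- ?s"] C by (intro mult_right_mono) auto
    also have "\<dots> = exp (- (\<Sum>k=1..N + Suc m. s k)) * C"
      by (simp add: exp_add[symmetric] mult.assoc[symmetric] add.commute)
    finally show ?case .
  qed
  have "((\<lambda>x. exp (- x) * C) \<longlongrightarrow> 0 * C) at_top"
    by (intro tendsto_intros filterlim_compose[OF exp_at_bot filterlim_uminus_at_bot_at_top])
  then have "(\<lambda>n. exp (- (\<Sum>k=1..n. s k)) * C) \<longlonglongrightarrow> 0 * C"
    by (rule filterlim_compose[OF _ div])
  then have "eventually (\<lambda>n. exp (- (\<Sum>k=1..n. s k)) * C < e) sequentially"
    using e by (intro order_tendstoD) auto
  then obtain M where M: "\<And>n. n \<ge> M \<Longrightarrow> exp (- (\<Sum>k=1..n. s k)) * C < e"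
    by (auto simp: eventually_sequentially)
  have "\<Phi> n < \<eta> + e" if "n \<ge> Suc (N + M)" for n
  proof -
    define m where "m = n - Suc N"
    have m: "n = Suc (N + m)" "M \<le> N + m"
      using that by (auto simp: m_def)
    show ?thesis using le_less_trans[OF bound M[OF m(2)]] m(1) by (simp add: algebra_simps)
  qed
  then show ?thesis unfolding eventually_sequentially by blast
qed

text \<open>The recursion is implicit because \<open>b\<close> is evaluated at the new iterate.
  Moving \<open>s n / 2 * \<Phi> (Suc n)\<close> to the left leaves the same factor
  \<open>1 - s n / 2\<close> on both sides of the induction step.\<close>

lemma perturbed_contraction_bounded:
  fixes \<Phi> s :: "nat \<Rightarrow> real"
  assumes s: "\<And>n. n \<ge> N \<Longrightarrow> 0 \<le> s n \<and> s n \<le> 1"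
    and rec: "\<And>n. n \<ge> N \<Longrightarrow> \<Phi> (Suc n) \<le> (1 - s n) * \<Phi> n + s n / 2 * \<Phi> (Suc n) + s n * M"
    and n: "n \<ge> N"
  shows "\<Phi> n \<le> max (\<Phi> N) (2 * M)"
  using n
proof (induction n rule: dec_induct)
  case (step n)
  let ?B = "max (\<Phi> N) (2 * M)"
  have "(1 - s n) * \<Phi> n \<le> (1 - s n) * ?B"
    using step s[of n] by (intro mult_left_mono) auto
  moreover have "s n * (2 * M) \<le> s n * ?B"
    using step s[of n] by (intro mult_left_mono) auto
  ultimately have "(1 - s n / 2) * \<Phi> (Suc n) \<le> (1 - s n / 2) * ?B"
    using rec[of n] step by (simp add: algebra_simps)
  moreover have "0 < 1 - s n / 2" using s[of n] step by simp
  ultimately show ?case by (simp add: mult_le_cancel_left)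
qed simp

text \<open>Subtracting the partial sums of \<open>c\<close> leaves a decreasing sequence that is
  bounded below. For the step sizes, a positive limit makes consecutive ratios tend to 1.\<close>

lemma quasi_decreasing_convergent:
  fixes \<delta> c :: "nat \<Rightarrow> real"
  assumes step: "\<And>n. n \<ge> 1 \<Longrightarrow> \<delta> (Suc n) \<le> \<delta> n + c n" and lower: "\<And>n. n \<ge> 1 \<Longrightarrow> m \<le> \<delta> n"
    and c: "\<And>n. n \<ge> 1 \<Longrightarrow> 0 \<le> c n" "summable (\<lambda>n. c (Suc n))"
  obtains d where "\<delta> \<longlonglongrightarrow> d" "m \<le> d"
proof -
  define y where "y n = \<delta> (Suc n) - (\<Sum>k<n. c (Suc k))" for n
  have "decseq y"
    unfolding y_def decseq_Suc_iff using step by (simp add: algebra_simps)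
  moreover have "m - (\<Sum>k. c (Suc k)) \<le> y n" for n
    using lower[of "Suc n"] sum_le_suminf[OF c(2), of "{..<n}"] c(1) by (simp add: y_def)
  ultimately obtain l where "y \<longlonglongrightarrow> l" using decseq_convergent by metis
  then have "(\<lambda>n. y n + (\<Sum>k<n. c (Suc k))) \<longlonglongrightarrow> l + (\<Sum>k. c (Suc k))"
    by (intro tendsto_add summable_LIMSEQ c(2))
  then have "(\<lambda>n. \<delta> (Suc n)) \<longlonglongrightarrow> l + (\<Sum>k. c (Suc k))"
    by (simp add: y_def)
  then have lim: "\<delta> \<longlonglongrightarrow> l + (\<Sum>k. c (Suc k))"
    by (rule LIMSEQ_imp_Suc)
  moreover have "m \<le> l + (\<Sum>k. c (Suc k))"
    by (rule LIMSEQ_le_const[OF lim]) (use lower in blast)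
  ultimately show ?thesis using that by blast
qed

subsection \<open>The Lyapunov function\<close>

lemma two_inner_le_weighted:
  fixes e x y :: "'a::real_inner"
  assumes "0 \<le> k" "norm e \<le> k * norm x"
  shows "2 * (e \<bullet> y) \<le> k * ((norm x)\<^sup>2 + (norm y)\<^sup>2)"
proof -
  have "e \<bullet> y \<le> norm e * norm y" by (rule norm_cauchy_schwarz)
  also have "\<dots> \<le> k * norm x * norm y" using assms by (intro mult_right_mono) auto
  finally have "2 * (e \<bullet> y) \<le> k * (2 * norm x * norm y)" by (simp add: algebra_simps)
  also have "\<dots> \<le> k * ((norm x)\<^sup>2 + (norm y)\<^sup>2)"
    using assms(1) sum_squares_bound[of "norm x" "norm y"] by (intro mult_left_mono) auto
  finally show ?thesis .
qed

lemma norm_sq_le_two: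
  fixes x y :: "'a::real_inner"
  shows "(norm x)\<^sup>2 \<le> 2 * (norm y)\<^sup>2 + 2 * (norm (y - x))\<^sup>2"
proof -
  have "2 * (norm y)\<^sup>2 + 2 * (norm (y - x))\<^sup>2 = (norm x)\<^sup>2 + (norm (2 *\<^sub>R y - x))\<^sup>2"
    by (simp add: power2_norm_eq_inner inner_simps inner_commute algebra_simps)
  then show ?thesis by simp
qed

text \<open>Here \<open>x\<close>, \<open>y\<close>, \<open>z\<close> stand for \<open>w\<^sub>n\<^sub>-\<^sub>1 - p\<close>, \<open>w\<^sub>n - p\<close>, \<open>w\<^sub>n\<^sub>+\<^sub>1 - p\<close> with \<open>p\<close> a zero of
  \<open>S + T\<close>, and \<open>e\<close>, \<open>f\<close>, \<open>h\<close>, \<open>v\<close>, \<open>g\<close> for \<open>T w\<^sub>n - T w\<^sub>n\<^sub>-\<^sub>1\<close>, \<open>T w\<^sub>n - T p\<close>,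
  \<open>T w\<^sub>n\<^sub>+\<^sub>1 - T w\<^sub>n\<close>, \<open>U w\<^sub>n - U p\<close>, \<open>U p - p\<close>.\<close>

lemma lyapunov_step:
  fixes x y z e f g h v :: "'a::real_inner"
  assumes opt: "0 \<le> (\<sigma> *\<^sub>R (g + v) + (1 - \<sigma>) *\<^sub>R (y + \<theta> *\<^sub>R (y - x)) - z - \<delta> *\<^sub>R f
                    - (\<delta>' * \<gamma>) *\<^sub>R e) \<bullet> z"
    and mono: "0 \<le> (f + h) \<bullet> z" and \<delta>: "0 \<le> \<delta>" "0 \<le> \<delta>'"
    and v: "norm v \<le> \<kappa> * norm y" and e: "\<delta>' * norm e \<le> k * norm (y - x)" and k: "0 \<le> k"
    and \<kappa>: "0 \<le> \<kappa>" "\<kappa> \<le> 1" and \<sigma>: "0 \<le> \<sigma>" "\<sigma> \<le> 1" and \<gamma>: "\<gamma> = 1 - \<sigma> * (1 - 2 * \<kappa>)"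
    and \<theta>: "0 \<le> \<theta>" "\<theta> \<le> 1/4"
    and c1: "2 * \<theta> * (1 - \<sigma>) + \<gamma> * k + 4 * \<kappa> * \<theta> * \<sigma> + \<epsilon> \<le> \<gamma> / 2"
    and c2: "1 / 2 + \<gamma> * k + \<epsilon> \<le> (1 - \<sigma>) * (1 - \<theta>)"
  shows "(norm z)\<^sup>2 - 2 * \<delta> * (h \<bullet> z) - \<theta> * (norm y)\<^sup>2 + (norm (z - y))\<^sup>2 / 2
    \<le> \<gamma> * ((norm y)\<^sup>2 - 2 * \<delta>' * (e \<bullet> y) - \<theta> * (norm x)\<^sup>2 + (norm (y - x))\<^sup>2 / 2)
      + 2 * \<sigma> * (g \<bullet> z) - \<epsilon> * ((norm (y - x))\<^sup>2 + (norm (z - y))\<^sup>2)"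
proof -
  define X Y Z D E where "X = (norm x)\<^sup>2" and "Y = (norm y)\<^sup>2" and "Z = (norm z)\<^sup>2"
    and "D = (norm (y - x))\<^sup>2" and "E = (norm (z - y))\<^sup>2"
  have nonneg: "0 \<le> X" "0 \<le> Y" "0 \<le> Z" "0 \<le> D" "0 \<le> E"
    by (simp_all add: X_def Y_def Z_def D_def E_def)
  have \<gamma>0: "0 \<le> \<gamma>"
  proof -
    have "\<sigma> * (1 - 2 * \<kappa>) \<le> \<sigma> * 1"
      using \<sigma> \<kappa> by (intro mult_left_mono) auto
    then show ?thesis unfolding \<gamma> using \<sigma> by simp
  qed
  have i1: "2 * ((z - y) \<bullet> z) = E + Z - Y"
    by (simp add: E_def Z_def Y_def power2_norm_eq_inner inner_simps inner_commute)
  have "2 * ((y - x) \<bullet> (z - y)) \<le> 1 * (D + E)"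
    unfolding D_def E_def by (rule two_inner_le_weighted) auto
  moreover have "2 * ((y - x) \<bullet> z) = 2 * ((y - x) \<bullet> (z - y)) + (D + Y - X)"
    by (simp add: D_def X_def Y_def power2_norm_eq_inner inner_simps inner_commute algebra_simps)
  ultimately have "2 * ((y - x) \<bullet> z) \<le> 2 * D + E + Y - X" by simp
  then have i2: "(1 - \<sigma>) * \<theta> * (2 * ((y - x) \<bullet> z)) \<le> (1 - \<sigma>) * \<theta> * (2 * D + E + Y - X)"
    using \<sigma> \<theta> by (intro mult_left_mono) auto
  have i3: "\<sigma> * (2 * (v \<bullet> z)) \<le> \<sigma> * (\<kappa> * (Y + Z))"
    unfolding Y_def Z_def using \<sigma> \<kappa> v by (intro mult_left_mono two_inner_le_weighted) auto
  have "2 * ((- (\<delta>' *\<^sub>R e)) \<bullet> (z - y)) \<le> k * (D + E)"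
    unfolding D_def E_def using e k \<delta> by (intro two_inner_le_weighted) auto
  then have i4: "\<gamma> * (2 * ((- (\<delta>' *\<^sub>R e)) \<bullet> (z - y))) \<le> \<gamma> * (k * (D + E))"
    using \<gamma>0 by (intro mult_left_mono)
  have i5: "0 \<le> 2 * \<delta> * (f \<bullet> z) + 2 * \<delta> * (h \<bullet> z)"
    using mult_nonneg_nonneg[OF \<delta>(1) mono] by (simp add: inner_simps algebra_simps)
  \<comment> \<open>Twice \<open>opt\<close>, with \<open>e \<bullet> z\<close> split at
    \<open>y\<close>: the part \<open>e \<bullet> y\<close> is the cross term of the old Lyapunov
    value and already carries the factor \<open>\<gamma>\<close>.\<close>
  have opt': "0 \<le> 2 * \<sigma> * (g \<bullet> z) + \<sigma> * (2 * (v \<bullet> z)) - (1 - \<sigma>) * (2 * ((z - y) \<bullet> z))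
      + (1 - \<sigma>) * \<theta> * (2 * ((y - x) \<bullet> z)) - 2 * \<sigma> * Z - 2 * \<delta> * (f \<bullet> z)
      + \<gamma> * (2 * ((- (\<delta>' *\<^sub>R e)) \<bullet> (z - y))) - \<gamma> * (2 * \<delta>' * (e \<bullet> y))"
    using opt by (simp add: Z_def power2_norm_eq_inner inner_simps algebra_simps)
  have main: "0 \<le> 2 * \<sigma> * (g \<bullet> z) + \<sigma> * (\<kappa> * (Y + Z)) - (1 - \<sigma>) * (E + Z - Y)
      + (1 - \<sigma>) * \<theta> * (2 * D + E + Y - X) - 2 * \<sigma> * Z + 2 * \<delta> * (h \<bullet> z)
      + \<gamma> * (k * (D + E)) - \<gamma> * (2 * \<delta>' * (e \<bullet> y))"
    using opt' i2 i3 i4 i5 unfolding i1 by linarith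
  have j1: "0 \<le> \<sigma> * (1 - \<kappa>) * Z" using \<sigma> \<kappa> nonneg by simp
  \<comment> \<open>\<open>\<gamma> * (\<theta> * X)\<close> exceeds the available
    \<open>(1 - \<sigma>) * \<theta> * X\<close> by
    \<open>2 * \<sigma> * \<kappa> * \<theta> * X\<close>. Splitting \<open>X\<close> charges this
    to \<open>D\<close>, whence \<open>4 * \<kappa> * \<theta> * \<sigma>\<close> in
    \<open>c1\<close>, and to the spare \<open>\<sigma> * \<kappa> * Y\<close>, which
    \<open>\<theta> \<le> 1/4\<close> permits.\<close>
  have "X \<le> 2 * Y + 2 * D" unfolding X_def Y_def D_def by (rule norm_sq_le_two)
  then have j2: "2 * \<sigma> * \<kappa> * \<theta> * X \<le> 2 * \<sigma> * \<kappa> * \<theta> * (2 * Y + 2 * D)"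
    using \<sigma> \<kappa> \<theta> by (intro mult_left_mono) auto
  have j3: "\<sigma> * \<kappa> * Y * (4 * \<theta>) \<le> \<sigma> * \<kappa> * Y * 1"
    using \<sigma> \<kappa> \<theta> nonneg by (intro mult_left_mono) auto
  have j4: "0 \<le> \<sigma> * \<theta> * Y" using \<sigma> \<theta> nonneg by simp
  have j5: "(2 * \<theta> * (1 - \<sigma>) + \<gamma> * k + 4 * \<kappa> * \<theta> * \<sigma> + \<epsilon>) * D \<le> \<gamma> / 2 * D"
    using c1 nonneg by (intro mult_right_mono) auto
  have j6: "(1 / 2 + \<gamma> * k + \<epsilon>) * E \<le> (1 - \<sigma>) * (1 - \<theta>) * E"
    using c2 nonneg by (intro mult_right_mono) auto
  have \<gamma>YX: "\<gamma> * Y = Y - \<sigma> * Y + 2 * \<sigma> * \<kappa> * Y" "\<gamma> * (\<theta> * X) = \<theta> * X - \<sigma> * \<theta> * X + 2 * \<sigma> * \<kappa> * \<theta> * X"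
    unfolding \<gamma> by (simp_all add: algebra_simps)
  have "Z - 2 * \<delta> * (h \<bullet> z) - \<theta> * Y + E / 2
    \<le> (\<gamma> * Y - \<gamma> * (2 * \<delta>' * (e \<bullet> y)) - \<gamma> * (\<theta> * X) + \<gamma> / 2 * D)
      + 2 * \<sigma> * (g \<bullet> z) - \<epsilon> * (D + E)"
    unfolding \<gamma>YX using main j1 j2 j3 j4 j5 j6 by (simp only: algebra_simps)
  then show ?thesis
    unfolding X_def Y_def Z_def D_def E_def by (simp add: algebra_simps)
qed

text \<open>The cross term and the inertial term together cost at most
  \<open>k + 2 * \<theta>\<close> times the sum of the two squares, hence at most half of it; the
  increment term pays for its own share.\<close>

lemma lyapunov_lower_bound:
  fixes x y e :: "'a::real_inner"
  assumes e: "\<delta>' * norm e \<le> k * norm (y - x)" and k: "0 \<le> k" "0 \<le> \<delta>'" "0 \<le> \<theta>" "k + 2 * \<theta> \<le> 1/2"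
  shows "(norm y)\<^sup>2 / 2 \<le> (norm y)\<^sup>2 - 2 * \<delta>' * (e \<bullet> y) - \<theta> * (norm x)\<^sup>2 + (norm (y - x))\<^sup>2 / 2"
proof -
  have "2 * ((\<delta>' *\<^sub>R e) \<bullet> y) \<le> k * ((norm (y - x))\<^sup>2 + (norm y)\<^sup>2)"
    using e k by (intro two_inner_le_weighted) auto
  moreover have "\<theta> * (norm x)\<^sup>2 \<le> \<theta> * (2 * (norm y)\<^sup>2 + 2 * (norm (y - x))\<^sup>2)"
    using k by (intro mult_left_mono norm_sq_le_two)
  moreover have "(k + 2 * \<theta>) * ((norm y)\<^sup>2 + (norm (y - x))\<^sup>2) \<le> 1/2 * ((norm y)\<^sup>2 + (norm (y - x))\<^sup>2)"
    using k by (intro mult_right_mono) auto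
  ultimately show ?thesis by (simp add: algebra_simps)
qed

text \<open>Replaces the weak cluster point argument: \<open>p\<close> will be the projection of \<open>x\<close> onto the
  zeros, \<open>u\<close> a resolvent approximation of \<open>p\<close>, and \<open>e\<close> a small element of \<open>A z\<close>.\<close>

lemma approx_zero_variational:
  assumes A: "monotone_operator A" and u: "(1 / l) *\<^sub>R (x - u) \<in> A u" and e: "e \<in> A z" and l: "l > 0"
  shows "(x - p) \<bullet> (z - p) \<le> l * (norm e * norm (z - u)) + norm (u - p) * (norm (x - p) + norm (z - u))"
proof -
  have "0 \<le> l * (((1 / l) *\<^sub>R (x - u) - e) \<bullet> (u - z))"
    using monotone_operatorD[OF A u e] l by simp
  also have "\<dots> = (x - u) \<bullet> (u - z) + l * (e \<bullet> (z - u))"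
    using l by (simp add: inner_simps algebra_simps)
  finally have "(x - u) \<bullet> (z - u) \<le> l * (e \<bullet> (z - u))"
    by (simp add: inner_simps algebra_simps)
  also have "\<dots> \<le> l * (norm e * norm (z - u))"
    using l norm_cauchy_schwarz[of e "z - u"] by simp
  finally have "(x - u) \<bullet> (z - u) \<le> l * (norm e * norm (z - u))" .
  moreover have "(x - p) \<bullet> (z - p) = (x - u) \<bullet> (z - u) + (u - p) \<bullet> (x - p) + (u - p) \<bullet> (z - u)"
    by (simp add: inner_simps inner_commute algebra_simps)
  moreover have "(u - p) \<bullet> (x - p) \<le> norm (u - p) * norm (x - p)"
    "(u - p) \<bullet> (z - u) \<le> norm (u - p) * norm (z - u)"
    by (rule norm_cauchy_schwarz)+
  ultimately show ?thesis by (simp add: algebra_simps)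
qed

subsection \<open>Strong convergence\<close>

theorem theorem5p5:
  fixes S :: "'a::{real_inner, complete_space} \<Rightarrow> 'a set"
    and T U :: "'a \<Rightarrow> 'a"
    and L \<kappa> \<theta> \<beta> r :: real
    and \<sigma> c \<delta> :: "nat \<Rightarrow> real"
    and w :: "nat \<Rightarrow> 'a"
  assumes S_max: "maximal_monotone S"
    and T_mono: "\<forall>a b. (T a - T b) \<bullet> (a - b) \<ge> 0"
    and L_pos: "L > 0"
    and T_lip: "L-lipschitz_on UNIV T"
    and zeros_ne: "zeros_of_sum S T \<noteq> {}"
    and \<kappa>: "\<kappa> \<in> {0..<1/2}"
    and U_contr: "\<kappa>-lipschitz_on UNIV U"
    and \<delta>0: "\<delta> 0 > 0" and \<delta>1: "\<delta> 1 > 0"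
    and \<theta>: "\<theta> \<in> {0..<1}"
    and \<beta>: "\<beta> \<in> {0<..<1/4}"
    and r: "r \<in> {\<beta><..<(1 - 2 * \<beta>) / 2}"
    and \<sigma>: "\<forall>n\<ge>1. \<sigma> n \<in> {0<..<1}"
    and c_nonneg: "\<forall>n\<ge>1. c n \<ge> 0"
    and c_sum: "summable (\<lambda>n. c (Suc n))"
    and w_step: "\<forall>n\<ge>1. w (n + 1) = resolvent S (\<delta> n)
          (\<sigma> n *\<^sub>R U (w n) + (1 - \<sigma> n) *\<^sub>R (w n + \<theta> *\<^sub>R (w n - w (n - 1)))
           - \<delta> n *\<^sub>R T (w n)
           - (\<delta> (n - 1) * (1 - \<sigma> n * (1 - 2 * \<kappa>))) *\<^sub>R (T (w n) - T (w (n - 1))))"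
    and \<delta>_step: "\<forall>n\<ge>1. \<delta> (n + 1) =
          (if T (w n) \<noteq> T (w (n + 1))
           then min (r * norm (w n - w (n + 1)) / norm (T (w n) - T (w (n + 1)))) (\<delta> n + c n)
           else \<delta> n + c n)"
    and \<theta>_small: "0 \<le> \<theta>" "\<theta> < min (\<beta> / 2) ((1/2 - r) / 2)"
    and \<sigma>_lim: "\<sigma> \<longlonglongrightarrow> 0"
    and \<sigma>_sum: "filterlim (\<lambda>N. \<Sum>n=1..N. \<sigma> n) at_top sequentially"
  shows "\<exists>\<omega>. \<omega> = metric_projection (zeros_of_sum S T) (U \<omega>)
           \<and> (\<forall>v. v = metric_projection (zeros_of_sum S T) (U v) \<longrightarrow> v = \<omega>)
           \<and> w \<longlonglongrightarrow> \<omega>"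
proof -

  \<comment> \<open>The sum operator and the fixed point\<close>
  define A where "A = (\<lambda>w. (\<lambda>u. u + T w) ` S w)"
  define Z where "Z = zeros_of_sum S T"
  have Z: "Z = {w. 0 \<in> A w}" by (simp add: Z_def A_def zeros_of_sum_def)
  have A_max: "maximal_monotone A"
    unfolding A_def using S_max T_mono T_lip by (intro maximal_monotone_add_lipschitz) auto
  have A_mono: "monotone_operator A" and S_mono: "monotone_operator S"
    using A_max S_max by (simp_all add: maximal_monotone_def)
  obtain q where q: "0 \<in> A q" using zeros_ne Z unfolding Z_def by auto
  have \<kappa>01: "0 \<le> \<kappa>" "\<kappa> < 1/2" using \<kappa> by auto
  define \<nu> where "\<nu> = 1 - 2 * \<kappa>"
  have \<nu>: "0 < \<nu>" "\<nu> \<le> 1" using \<kappa>01 by (auto simp: \<nu>_def)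
  have r01: "0 < r" "r < 1/2" using r \<beta> by auto
  have \<theta>01: "0 \<le> \<theta>" "\<theta> < 1/8" "r + 2 * \<theta> < 1/2" using \<theta>_small \<beta> by auto
  have \<sigma>01: "0 < \<sigma> n" "\<sigma> n < 1" if "n \<ge> 1" for n using \<sigma> that by auto

  have "dist (metric_projection Z (U x)) (metric_projection Z (U y)) \<le> \<kappa> * dist x y" for x y
    using metric_projection_zeros_nonexpansive[OF A_max q, of "U x" "U y"]
      lipschitz_onD[OF U_contr, of x y] unfolding Z by (simp add: dist_norm)
  then have "\<exists>!v. metric_projection Z (U v) = v"
    using \<kappa>01 by (intro banach_fix_type[where c = \<kappa>]) auto
  then obtain \<omega> where \<omega>: "metric_projection Z (U \<omega>) = \<omega>"
    and \<omega>_unique: "\<And>v. metric_projection Z (U v) = v \<Longrightarrow> v = \<omega>" by blast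
  \<comment> \<open>The limit \<open>p\<close> turns out to be \<open>\<omega>\<close>; the
    approximants \<open>u k\<close> are kept for the estimate of \<open>b\<close> at the
    end.\<close>
  obtain u p where u: "\<And>k. (1 / real (Suc k)) *\<^sub>R (U \<omega> - u k) \<in> A (u k)" "u \<longlonglongrightarrow> p" "0 \<in> A p"
    and p_var: "\<And>q. 0 \<in> A q \<Longrightarrow> (U \<omega> - p) \<bullet> (q - p) \<le> 0"
    using resolvent_tendsto_zero[OF A_max q, of "U \<omega>"] by blast
  have "metric_projection Z (U \<omega>) = p"
    using u(3) p_var by (intro metric_projectionI) (auto simp: Z)
  with \<omega> have p: "p = \<omega>" by simp
  have S\<omega>: "- T \<omega> \<in> S \<omega>"
    using u(3) unfolding p A_def by (auto simp flip: eq_neg_iff_add_eq_0)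

  \<comment> \<open>Bounds and limit of the step sizes\<close>
  define m where "m = min (\<delta> 1) (r / L)"
  have m: "0 < m" using \<delta>1 r01 L_pos by (simp add: m_def)
  have \<delta>_lower: "m \<le> \<delta> n" if "n \<ge> 1" for n
    using that
  proof (induction n rule: dec_induct)
    case base
    then show ?case by (simp add: m_def)
  next
    case (step n)
    have "m \<le> \<delta> n + c n" using step c_nonneg by (simp add: add_increasing2)
    moreover have "m \<le> r * norm (w n - w (n + 1)) / norm (T (w n) - T (w (n + 1)))"
      if "T (w n) \<noteq> T (w (n + 1))"
    proof -
      have "norm (T (w n) - T (w (n + 1))) \<le> L * norm (w n - w (n + 1))"
        using lipschitz_onD[OF T_lip, of "w n" "w (n + 1)"] by (simp add: dist_norm)
      then have "r / L * norm (T (w n) - T (w (n + 1))) \<le> r / L * (L * norm (w n - w (n + 1)))"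
        using r01 L_pos by (intro mult_left_mono) auto
      then have "r / L \<le> r * norm (w n - w (n + 1)) / norm (T (w n) - T (w (n + 1)))"
        using that L_pos by (simp add: pos_le_divide_eq)
      then show ?thesis by (simp add: m_def)
    qed
    ultimately show ?case using \<delta>_step step by simp
  qed
  have \<delta>_pos: "0 < \<delta> n" for n
    using \<delta>0 \<delta>_lower[of n] m by (cases n) auto
  have "\<delta> (Suc n) \<le> \<delta> n + c n" if "n \<ge> 1" for n
    using \<delta>_step that by (auto split: if_splits)
  then obtain d where d: "\<delta> \<longlonglongrightarrow> d" "m \<le> d"
    using quasi_decreasing_convergent[of \<delta> c m] \<delta>_lower c_nonneg c_sum by metis
  obtain \<Delta> where \<Delta>: "\<And>n. \<delta> n \<le> \<Delta>" "0 < \<Delta>"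
    using convergent_imp_Bseq[OF convergentI[OF d(1)]] unfolding Bseq_def
    by (metis abs_le_D1 real_norm_def)
  \<comment> \<open>The Lipschitz-type factor of \<open>T\<close> between consecutive iterates,
    scaled by the previous step size. It tends to \<open>r\<close>, so
    \<open>r + 2 * \<theta> < 1/2\<close> passes to \<open>k n\<close> for large
    \<open>n\<close>.\<close>
  define k where "k n = r * \<delta> (n - 1) / \<delta> n" for n
  have k_nonneg: "0 \<le> k n" for n
    using r01 \<delta>_pos by (simp add: k_def less_imp_le)
  have "(\<lambda>n. \<delta> (n - 1)) \<longlonglongrightarrow> d"
    by (rule LIMSEQ_imp_Suc) (use d(1) in simp)
  then have "k \<longlonglongrightarrow> r * d / d"
    unfolding k_def using d m by (intro tendsto_intros) auto
  then have k_lim: "k \<longlonglongrightarrow> r" using d(2) m by simp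
  \<comment> \<open>The bound starts at \<open>n = 2\<close>: \<open>\<delta> 1\<close> is
    prescribed freely, without reference to \<open>T (w 1) - T (w 0)\<close>.\<close>
  have k: "\<delta> (n - 1) * norm (T (w n) - T (w (n - 1))) \<le> k n * norm (w n - w (n - 1))"
    if "n \<ge> 2" for n
  proof -
    obtain l where l: "n = l + 1" "l \<ge> 1" using \<open>n \<ge> 2\<close> by (metis add.commute le_Suc_ex nat_1_add_1 add.assoc le_add1)
    have "\<delta> n * norm (T (w n) - T (w (n - 1))) \<le> r * norm (w n - w (n - 1))"
    proof (cases "T (w l) = T (w (l + 1))")
      case True
      then show ?thesis using r01 l by simp
    next
      case False
      then have "\<delta> n \<le> r * norm (w l - w (l + 1)) / norm (T (w l) - T (w (l + 1)))"
        using \<delta>_step l by simp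
      then have "\<delta> n * norm (T (w l) - T (w (l + 1))) \<le> r * norm (w l - w (l + 1))"
        using False by (simp add: pos_le_divide_eq)
      then show ?thesis by (simp add: l norm_minus_commute)
    qed
    then have "\<delta> (n - 1) / \<delta> n * (\<delta> n * norm (T (w n) - T (w (n - 1))))
        \<le> \<delta> (n - 1) / \<delta> n * (r * norm (w n - w (n - 1)))"
      using \<delta>_pos by (intro mult_left_mono) (simp_all add: less_imp_le)
    then show ?thesis
      using \<delta>_pos[of n] by (simp add: k_def mult_ac)
  qed

  \<comment> \<open>Lyapunov quantities and their asymptotic margin\<close>
  define s where "s n = \<sigma> n * \<nu>" for n
  define y where "y n = \<sigma> n *\<^sub>R U (w n) + (1 - \<sigma> n) *\<^sub>R (w n + \<theta> *\<^sub>R (w n - w (n - 1)))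
      - \<delta> n *\<^sub>R T (w n) - (\<delta> (n - 1) * (1 - s n)) *\<^sub>R (T (w n) - T (w (n - 1)))" for n
  define D where "D n = norm (w n - w (n - 1))" for n
  define b where "b n = (U \<omega> - \<omega>) \<bullet> (w n - \<omega>)" for n
  define \<Phi> where "\<Phi> n = (norm (w n - \<omega>))\<^sup>2 - 2 * \<delta> (n - 1) * ((T (w n) - T (w (n - 1))) \<bullet> (w n - \<omega>))
      - \<theta> * (norm (w (n - 1) - \<omega>))\<^sup>2 + (D n)\<^sup>2 / 2" for n
  have s01: "0 < s n" "s n < 1" if "n \<ge> 1" for n
    using \<sigma>01[OF that] \<nu> by (auto simp: s_def intro: mult_pos_pos le_less_trans[OF mult_left_le])
  have res: "\<exists>v\<in>S (w (n + 1)). w (n + 1) + \<delta> n *\<^sub>R v = y n" if "n \<ge> 1" for n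
    using resolvent_mem[OF S_max \<delta>_pos[of n], of "y n"] w_step that by (simp add: y_def s_def \<nu>_def)

  \<comment> \<open>Half the slack in \<open>r + 2 * \<theta> < 1/2\<close>. With
    \<open>\<sigma> n\<close> and \<open>k n\<close> replaced by their limits, \<open>c1\<close> and
    \<open>c2\<close> of \<open>lyapunov_step\<close> hold with room \<open>\<epsilon>\<close> and
    \<open>\<epsilon> + \<theta>\<close>.\<close>
  define \<epsilon> where "\<epsilon> = (1/2 - r - 2 * \<theta>) / 2"
  have \<epsilon>: "0 < \<epsilon>" using \<theta>01 by (simp add: \<epsilon>_def)
  have "(\<lambda>n. 2 * \<theta> * (1 - \<sigma> n) + (1 - \<sigma> n * (1 - 2 * \<kappa>)) * k n + 4 * \<kappa> * \<theta> * \<sigma> n + \<epsilon> - (1 - \<sigma> n * (1 - 2 * \<kappa>)) / 2)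
      \<longlonglongrightarrow> 2 * \<theta> * (1 - 0) + (1 - 0 * (1 - 2 * \<kappa>)) * r + 4 * \<kappa> * \<theta> * 0 + \<epsilon> - (1 - 0 * (1 - 2 * \<kappa>)) / 2"
    by (intro tendsto_intros \<sigma>_lim k_lim) auto
  then have ev1: "eventually (\<lambda>n. 2 * \<theta> * (1 - \<sigma> n) + (1 - \<sigma> n * (1 - 2 * \<kappa>)) * k n + 4 * \<kappa> * \<theta> * \<sigma> n + \<epsilon>
      - (1 - \<sigma> n * (1 - 2 * \<kappa>)) / 2 < 0) sequentially"
    by (rule order_tendstoD) (use \<theta>01 in \<open>simp add: \<epsilon>_def field_simps\<close>)
  have "(\<lambda>n. 1 / 2 + (1 - \<sigma> n * (1 - 2 * \<kappa>)) * k n + \<epsilon> - (1 - \<sigma> n) * (1 - \<theta>))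
      \<longlonglongrightarrow> 1 / 2 + (1 - 0 * (1 - 2 * \<kappa>)) * r + \<epsilon> - (1 - 0) * (1 - \<theta>)"
    by (intro tendsto_intros \<sigma>_lim k_lim)
  then have ev2: "eventually (\<lambda>n. 1 / 2 + (1 - \<sigma> n * (1 - 2 * \<kappa>)) * k n + \<epsilon> - (1 - \<sigma> n) * (1 - \<theta>) < 0) sequentially"
    by (rule order_tendstoD) (use \<theta>01 in \<open>simp add: \<epsilon>_def field_simps\<close>)
  have "(\<lambda>n. k n + 2 * \<theta>) \<longlonglongrightarrow> r + 2 * \<theta>"
    by (intro tendsto_intros k_lim)
  then have ev3: "eventually (\<lambda>n. k n + 2 * \<theta> < 1/2) sequentially"
    by (rule order_tendstoD) (use \<theta>01 in simp)
  obtain N where N: "N \<ge> 2"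
    and N1: "\<And>n. n \<ge> N \<Longrightarrow> 2 * \<theta> * (1 - \<sigma> n) + (1 - \<sigma> n * (1 - 2 * \<kappa>)) * k n + 4 * \<kappa> * \<theta> * \<sigma> n + \<epsilon>
        \<le> (1 - \<sigma> n * (1 - 2 * \<kappa>)) / 2"
    and N2: "\<And>n. n \<ge> N \<Longrightarrow> 1 / 2 + (1 - \<sigma> n * (1 - 2 * \<kappa>)) * k n + \<epsilon> \<le> (1 - \<sigma> n) * (1 - \<theta>)"
    and N3: "\<And>n. n \<ge> N \<Longrightarrow> k n + 2 * \<theta> \<le> 1/2"
  proof -
    have "eventually (\<lambda>n. n \<ge> 2 \<and> 2 * \<theta> * (1 - \<sigma> n) + (1 - \<sigma> n * (1 - 2 * \<kappa>)) * k n + 4 * \<kappa> * \<theta> * \<sigma> n + \<epsilon>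
        \<le> (1 - \<sigma> n * (1 - 2 * \<kappa>)) / 2 \<and> 1 / 2 + (1 - \<sigma> n * (1 - 2 * \<kappa>)) * k n + \<epsilon> \<le> (1 - \<sigma> n) * (1 - \<theta>)
        \<and> k n + 2 * \<theta> \<le> 1/2) sequentially"
      using ev1 ev2 ev3 eventually_ge_at_top[of 2] by eventually_elim simp
    then show ?thesis using that unfolding eventually_sequentially by (metis order_refl)
  qed

  \<comment> \<open>The Lyapunov recursion\<close>
  have step: "\<Phi> (Suc n) \<le> (1 - s n) * \<Phi> n + 2 * \<sigma> n * b (Suc n) - \<epsilon> * ((D n)\<^sup>2 + (D (Suc n))\<^sup>2)"
    if n: "n \<ge> N" for n
  proof -
    have n1: "n \<ge> 1" "n \<ge> 2" using n N by auto
    obtain v where v: "v \<in> S (w (n + 1))" "w (n + 1) + \<delta> n *\<^sub>R v = y n" using res[OF n1(1)] by blast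
    \<comment> \<open>Monotonicity of \<open>S\<close> is tested at the new iterate against the pair
      \<open>(\<omega>, - T \<omega>)\<close>; the factor \<open>\<delta> n\<close> allows the
      implicit step to be substituted.\<close>
    have "0 \<le> \<delta> n * ((v - - T \<omega>) \<bullet> (w (n + 1) - \<omega>))"
      using monotone_operatorD[OF S_mono v(1) S\<omega>] \<delta>_pos[of n] by simp
    also have "\<dots> = (\<delta> n *\<^sub>R v + \<delta> n *\<^sub>R T \<omega>) \<bullet> (w (n + 1) - \<omega>)"
      by (simp add: inner_simps algebra_simps)
    also have "\<delta> n *\<^sub>R v = y n - w (n + 1)" using v(2) by (simp add: algebra_simps)
    also have "y n - w (n + 1) + \<delta> n *\<^sub>R T \<omega>
      = \<sigma> n *\<^sub>R ((U \<omega> - \<omega>) + (U (w n) - U \<omega>))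
        + (1 - \<sigma> n) *\<^sub>R ((w n - \<omega>) + \<theta> *\<^sub>R ((w n - \<omega>) - (w (n - 1) - \<omega>)))
        - (w (n + 1) - \<omega>) - \<delta> n *\<^sub>R (T (w n) - T \<omega>)
        - (\<delta> (n - 1) * (1 - s n)) *\<^sub>R (T (w n) - T (w (n - 1)))"
      by (simp add: y_def algebra_simps)
    finally have opt: "0 \<le> \<dots> \<bullet> (w (n + 1) - \<omega>)" .
    have "(norm (w (n + 1) - \<omega>))\<^sup>2 - 2 * \<delta> n * ((T (w (n + 1)) - T (w n)) \<bullet> (w (n + 1) - \<omega>))
        - \<theta> * (norm (w n - \<omega>))\<^sup>2 + (norm ((w (n + 1) - \<omega>) - (w n - \<omega>)))\<^sup>2 / 2
      \<le> (1 - s n) * ((norm (w n - \<omega>))\<^sup>2 - 2 * \<delta> (n - 1) * ((T (w n) - T (w (n - 1))) \<bullet> (w n - \<omega>))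
        - \<theta> * (norm (w (n - 1) - \<omega>))\<^sup>2 + (norm ((w n - \<omega>) - (w (n - 1) - \<omega>)))\<^sup>2 / 2)
        + 2 * \<sigma> n * ((U \<omega> - \<omega>) \<bullet> (w (n + 1) - \<omega>))
        - \<epsilon> * ((norm ((w n - \<omega>) - (w (n - 1) - \<omega>)))\<^sup>2 + (norm ((w (n + 1) - \<omega>) - (w n - \<omega>)))\<^sup>2)"
    proof (rule lyapunov_step[OF opt])
      show "0 \<le> (T (w n) - T \<omega> + (T (w (n + 1)) - T (w n))) \<bullet> (w (n + 1) - \<omega>)"
        using T_mono by simp
      show "norm (U (w n) - U \<omega>) \<le> \<kappa> * norm (w n - \<omega>)"
        using lipschitz_onD[OF U_contr, of "w n" \<omega>] by (simp add: dist_norm)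
      show "\<delta> (n - 1) * norm (T (w n) - T (w (n - 1))) \<le> k n * norm (w n - \<omega> - (w (n - 1) - \<omega>))"
        using k[OF n1(2)] by simp
      show "1 - s n = 1 - \<sigma> n * (1 - 2 * \<kappa>)" by (simp add: s_def \<nu>_def)
      show "2 * \<theta> * (1 - \<sigma> n) + (1 - s n) * k n + 4 * \<kappa> * \<theta> * \<sigma> n + \<epsilon> \<le> (1 - s n) / 2"
        using N1[OF n] by (simp add: s_def \<nu>_def)
      show "1 / 2 + (1 - s n) * k n + \<epsilon> \<le> (1 - \<sigma> n) * (1 - \<theta>)"
        using N2[OF n] by (simp add: s_def \<nu>_def)
    qed (use \<delta>_pos[of n] \<delta>_pos[of "n - 1"] k_nonneg[of n] \<kappa>01 \<sigma>01[OF n1(1)] \<theta>01 in auto)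
    then show ?thesis by (simp add: \<Phi>_def D_def b_def)
  qed
  have lower: "(norm (w n - \<omega>))\<^sup>2 / 2 \<le> \<Phi> n" if n: "n \<ge> N" for n
  proof -
    have "\<delta> (n - 1) * norm (T (w n) - T (w (n - 1))) \<le> k n * norm ((w n - \<omega>) - (w (n - 1) - \<omega>))"
      using k[of n] n N by simp
    from lyapunov_lower_bound[OF this k_nonneg less_imp_le[OF \<delta>_pos] \<theta>01(1) N3[OF n]]
    show ?thesis by (simp add: \<Phi>_def D_def)
  qed

  \<comment> \<open>Boundedness of the iterates\<close>
  define G where "G = norm (U \<omega> - \<omega>)"
  have bounded: "\<Phi> n \<le> max (\<Phi> N) (2 * (4 * G\<^sup>2 / \<nu>\<^sup>2))" if "n \<ge> N" for n
  proof (rule perturbed_contraction_bounded[OF _ _ that])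
    fix n assume n: "n \<ge> N"
    then have n1: "n \<ge> 1" using N by simp
    show "0 \<le> s n \<and> s n \<le> 1" using s01[OF n1] by simp
    define t where "t = norm (w (Suc n) - \<omega>)"
    have "2 * b (Suc n) \<le> 2 * (G * t)"
      unfolding b_def G_def t_def using norm_cauchy_schwarz by simp
    \<comment> \<open>Young's inequality is weighted so that, as
      \<open>t\<^sup>2 \<le> 2 * \<Phi> (Suc n)\<close>, the quadratic part costs exactly the share
      \<open>\<nu> / 2\<close> allowed by \<open>perturbed_contraction_bounded\<close>.\<close>
    also have "\<dots> \<le> \<nu> / 4 * t\<^sup>2 + 4 * G\<^sup>2 / \<nu>"
    proof -
      have "0 \<le> (\<nu> * t - 4 * G)\<^sup>2 / (4 * \<nu>)" using \<nu> by simp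
      also have "\<dots> = \<nu> / 4 * t\<^sup>2 + 4 * G\<^sup>2 / \<nu> - 2 * (G * t)"
        using \<nu> by (simp add: power2_eq_square field_simps)
      finally show ?thesis by simp
    qed
    also have "\<dots> \<le> \<nu> / 2 * \<Phi> (Suc n) + 4 * G\<^sup>2 / \<nu>"
      using mult_left_mono[OF lower[of "Suc n"], of "\<nu> / 2"] n \<nu> by (simp add: t_def)
    finally have "\<sigma> n * (2 * b (Suc n)) \<le> \<sigma> n * (\<nu> / 2 * \<Phi> (Suc n) + 4 * G\<^sup>2 / \<nu>)"
      using \<sigma>01[OF n1] by (intro mult_left_mono) auto
    moreover have "\<dots> = s n / 2 * \<Phi> (Suc n) + s n * (4 * G\<^sup>2 / \<nu>\<^sup>2)"
      using \<nu> by (simp add: s_def power2_eq_square field_simps)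
    moreover have "\<sigma> n * (2 * b (Suc n)) = 2 * \<sigma> n * b (Suc n)" by simp
    moreover have "0 \<le> \<epsilon> * ((D n)\<^sup>2 + (D (Suc n))\<^sup>2)" using \<epsilon> by simp
    ultimately show "\<Phi> (Suc n) \<le> (1 - s n) * \<Phi> n + s n / 2 * \<Phi> (Suc n) + s n * (4 * G\<^sup>2 / \<nu>\<^sup>2)"
      using step[OF n] by linarith
  qed
  obtain R where R: "\<And>n. n \<ge> N \<Longrightarrow> norm (w n - \<omega>) \<le> R" "0 \<le> R"
  proof
    define B where "B = max (\<Phi> N) (2 * (4 * G\<^sup>2 / \<nu>\<^sup>2))"
    have B: "0 \<le> B" using \<nu> by (simp add: B_def le_max_iff_disj)
    show "norm (w n - \<omega>) \<le> sqrt (2 * B)" if "n \<ge> N" for n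
      using lower[OF that] bounded[OF that] by (intro real_le_rsqrt) (simp add: B_def)
    show "0 \<le> sqrt (2 * B)" using B by simp
  qed

  \<comment> \<open>Small elements of the sum operator at the iterates\<close>
  define C where "C = (2 * R + G + 1 + \<Delta> * L) / m"
  have G0: "0 \<le> G" by (simp add: G_def)
  have C0: "0 \<le> C" using R G0 \<Delta> L_pos m by (simp add: C_def)
  have residual: "\<exists>e\<in>A (w (Suc n)). norm e \<le> C * (\<sigma> n + D n + D (Suc n))" if n: "n \<ge> N" for n
  proof -
    have n1: "n \<ge> 1" using n N by simp
    obtain v where v: "v \<in> S (w (n + 1))" "w (n + 1) + \<delta> n *\<^sub>R v = y n" using res[OF n1] by blast
    \<comment> \<open>Adding \<open>T\<close> at the new iterate puts \<open>e\<close> into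
      \<open>A (w (Suc n))\<close>. Then \<open>\<delta> n *\<^sub>R e\<close> consists of
      increments of \<open>w\<close> and \<open>T\<close> and of \<open>\<sigma> n\<close> times a
      bounded vector, and \<open>m \<le> \<delta> n\<close> allows division.\<close>
    define e where "e = v + T (w (n + 1))"
    have D0: "0 \<le> D n" "0 \<le> D (Suc n)" by (simp_all add: D_def)
    have T_le: "norm (T a - T b) \<le> L * norm (a - b)" for a b
      using lipschitz_onD[OF T_lip, of a b] by (simp add: dist_norm)
    have "U (w n) - w n = (U (w n) - U \<omega>) + (U \<omega> - \<omega>) - (w n - \<omega>)" by simp
    then have "norm (U (w n) - w n) \<le> norm (U (w n) - U \<omega>) + G + norm (w n - \<omega>)"
      using norm_triangle_ineq4[of "(U (w n) - U \<omega>) + (U \<omega> - \<omega>)" "w n - \<omega>"]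
        norm_triangle_ineq[of "U (w n) - U \<omega>" "U \<omega> - \<omega>"] by (simp add: G_def)
    moreover have "norm (U (w n) - U \<omega>) \<le> \<kappa> * norm (w n - \<omega>)"
      using lipschitz_onD[OF U_contr, of "w n" \<omega>] by (simp add: dist_norm)
    moreover have "\<kappa> * norm (w n - \<omega>) \<le> 1 * norm (w n - \<omega>)"
      using \<kappa>01 by (intro mult_right_mono) auto
    ultimately have U_le: "norm (U (w n) - w n) \<le> 2 * R + G" using R(1)[OF n] by simp
    have "\<delta> n *\<^sub>R v = y n - w (n + 1)" using v(2) by (simp add: algebra_simps)
    then have "\<delta> n *\<^sub>R e = \<sigma> n *\<^sub>R (U (w n) - w n) + ((1 - \<sigma> n) * \<theta>) *\<^sub>R (w n - w (n - 1))
        + (w n - w (Suc n)) + \<delta> n *\<^sub>R (T (w (Suc n)) - T (w n))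
        + (\<delta> (n - 1) * (1 - s n)) *\<^sub>R (T (w (n - 1)) - T (w n))"
      by (simp add: e_def y_def algebra_simps)
    then have "\<delta> n * norm e \<le> norm (\<sigma> n *\<^sub>R (U (w n) - w n)) + norm (((1 - \<sigma> n) * \<theta>) *\<^sub>R (w n - w (n - 1)))
        + norm (w n - w (Suc n)) + norm (\<delta> n *\<^sub>R (T (w (Suc n)) - T (w n)))
        + norm ((\<delta> (n - 1) * (1 - s n)) *\<^sub>R (T (w (n - 1)) - T (w n)))"
      using \<delta>_pos[of n] by (smt (verit) norm_scaleR norm_triangle_ineq)
    also have "norm (\<sigma> n *\<^sub>R (U (w n) - w n)) \<le> \<sigma> n * (2 * R + G)"
      using \<sigma>01[OF n1] U_le by simp
    also have "norm (((1 - \<sigma> n) * \<theta>) *\<^sub>R (w n - w (n - 1))) \<le> 1 * D n"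
      unfolding norm_scaleR D_def using \<sigma>01[OF n1] \<theta>01
      by (intro mult_right_mono) (auto simp: abs_mult intro!: mult_le_one)
    also have "norm (w n - w (Suc n)) = D (Suc n)" by (simp add: D_def norm_minus_commute)
    also have "norm (\<delta> n *\<^sub>R (T (w (Suc n)) - T (w n))) \<le> \<Delta> * (L * D (Suc n))"
      unfolding norm_scaleR D_def using \<delta>_pos[of n] \<Delta> T_le by (intro mult_mono) auto
    also have "norm ((\<delta> (n - 1) * (1 - s n)) *\<^sub>R (T (w (n - 1)) - T (w n))) \<le> (\<Delta> * 1) * (L * D n)"
      unfolding norm_scaleR abs_mult
      using \<delta>_pos[of "n - 1"] \<Delta> s01[OF n1] T_le[of "w (n - 1)" "w n"]
      by (intro mult_mono) (auto simp: D_def norm_minus_commute)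
    finally have "\<delta> n * norm e \<le> (2 * R + G) * \<sigma> n + (1 + \<Delta> * L) * (D n + D (Suc n))"
      by (simp add: algebra_simps)
    also have "\<dots> \<le> (2 * R + G + 1 + \<Delta> * L) * (\<sigma> n + D n + D (Suc n))"
    proof -
      have "0 \<le> (1 + \<Delta> * L) * \<sigma> n" "0 \<le> (2 * R + G) * (D n + D (Suc n))"
        using \<sigma>01[OF n1] \<Delta> L_pos R(2) G0 D0 by simp_all
      then show ?thesis by (simp add: algebra_simps)
    qed
    finally have "m * norm e \<le> (2 * R + G + 1 + \<Delta> * L) * (\<sigma> n + D n + D (Suc n))"
      using mult_right_mono[OF \<delta>_lower[OF n1], of "norm e"] by simp
    then have "norm e \<le> C * (\<sigma> n + D n + D (Suc n))"
      using m by (simp add: C_def pos_le_divide_eq mult.commute)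
    moreover have "e \<in> A (w (Suc n))" using v(1) by (simp add: A_def e_def)
    ultimately show ?thesis by blast
  qed

  \<comment> \<open>Decay of the Lyapunov values\<close>
  have small: "eventually (\<lambda>n. \<Phi> n < \<tau>) sequentially" if \<tau>: "\<tau> > 0" for \<tau>
  proof -
    \<comment> \<open>Chosen so that \<open>3 * \<eta> / \<nu> = \<tau> / 2\<close>; the other half
      of \<open>\<tau>\<close> serves as the margin in
      \<open>perturbed_contraction_eventually_less\<close>.\<close>
    define \<eta> where "\<eta> = \<tau> * \<nu> / 6"
    have \<eta>: "0 < \<eta>" using \<tau> \<nu> by (simp add: \<eta>_def)
    have "(\<lambda>j. norm (u j - \<omega>) * (G + (R + norm (u j - \<omega>)))) \<longlonglongrightarrow> norm (\<omega> - \<omega>) * (G + (R + norm (\<omega> - \<omega>)))"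
      using u(2) unfolding p by (intro tendsto_intros)
    then have "eventually (\<lambda>j. norm (u j - \<omega>) * (G + (R + norm (u j - \<omega>))) < \<eta>) sequentially"
      using \<eta> by (intro order_tendstoD) auto
    then obtain j where j: "norm (u j - \<omega>) * (G + (R + norm (u j - \<omega>))) < \<eta>"
      by (auto simp: eventually_sequentially)
    \<comment> \<open>The index \<open>j\<close> is fixed before \<open>n\<close> grows, so the
      possibly large factor \<open>real (Suc j)\<close> is a constant.\<close>
    define K where "K = real (Suc j) * C * (R + norm (u j - \<omega>))"
    have K0: "0 \<le> K" using C0 R by (simp add: K_def)
    have b_le: "b (Suc n) \<le> \<eta> + K * (\<sigma> n + D n + D (Suc n))" if n: "n \<ge> N" for n
    proof -
      obtain e where e: "e \<in> A (w (Suc n))" "norm e \<le> C * (\<sigma> n + D n + D (Suc n))"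
        using residual[OF n] by blast
      have wu: "norm (w (Suc n) - u j) \<le> R + norm (u j - \<omega>)"
        using R(1)[of "Suc n"] n norm_triangle_ineq4[of "w (Suc n) - \<omega>" "u j - \<omega>"] by simp
      have "b (Suc n) \<le> real (Suc j) * (norm e * norm (w (Suc n) - u j))
          + norm (u j - \<omega>) * (norm (U \<omega> - \<omega>) + norm (w (Suc n) - u j))"
        unfolding b_def by (rule approx_zero_variational[OF A_mono u(1) e(1)]) simp
      also have "\<dots> \<le> real (Suc j) * (C * (\<sigma> n + D n + D (Suc n)) * (R + norm (u j - \<omega>)))
          + norm (u j - \<omega>) * (G + (R + norm (u j - \<omega>)))"
        using e(2) wu order_trans[OF norm_ge_zero e(2)] unfolding G_def
        by (intro add_mono mult_left_mono mult_mono) auto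
      finally show ?thesis using j by (simp add: K_def mult_ac)
    qed
    \<comment> \<open>Collects the leftovers of order \<open>(\<sigma> n)\<^sup>2\<close>: one from
      \<open>K * \<sigma> n\<close> and two from Young's inequality, for \<open>D n\<close> and
      \<open>D (Suc n)\<close>.\<close>
    define M where "M = 2 * K + 2 * K\<^sup>2 / \<epsilon>"
    have "(\<lambda>n. \<sigma> n * M) \<longlonglongrightarrow> 0 * M" by (intro tendsto_intros \<sigma>_lim)
    then have "eventually (\<lambda>n. \<sigma> n * M < \<eta>) sequentially" using \<eta> by (intro order_tendstoD) auto
    then obtain N' where N': "\<And>n. n \<ge> N' \<Longrightarrow> \<sigma> n * M < \<eta>" by (auto simp: eventually_sequentially)
    have rec: "\<Phi> (Suc n) \<le> (1 - s n) * \<Phi> n + s n * (3 * \<eta> / \<nu>)" if n: "n \<ge> max N N'" for n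
    proof -
      have n1: "n \<ge> 1" "n \<ge> N" using n N by auto
      have young: "2 * \<sigma> n * K * t \<le> \<epsilon> * t\<^sup>2 + (\<sigma> n)\<^sup>2 * K\<^sup>2 / \<epsilon>" for t
      proof -
        have "0 \<le> (\<epsilon> * t - \<sigma> n * K)\<^sup>2 / \<epsilon>" using \<epsilon> by simp
        also have "\<dots> = \<epsilon> * t\<^sup>2 + (\<sigma> n)\<^sup>2 * K\<^sup>2 / \<epsilon> - 2 * \<sigma> n * K * t"
          using \<epsilon> by (simp add: power2_eq_square field_simps)
        finally show ?thesis by simp
      qed
      have "2 * \<sigma> n * b (Suc n) \<le> 2 * \<sigma> n * (\<eta> + K * (\<sigma> n + D n + D (Suc n)))"
        using b_le[OF n1(2)] \<sigma>01[OF n1(1)] by (intro mult_left_mono) auto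
      also have "\<dots> = 2 * \<sigma> n * \<eta> + 2 * K * (\<sigma> n)\<^sup>2 + 2 * \<sigma> n * K * D n + 2 * \<sigma> n * K * D (Suc n)"
        by (simp add: power2_eq_square algebra_simps)
      finally have "2 * \<sigma> n * b (Suc n) - \<epsilon> * ((D n)\<^sup>2 + (D (Suc n))\<^sup>2)
          \<le> 2 * \<sigma> n * \<eta> + 2 * K * (\<sigma> n)\<^sup>2 + 2 * ((\<sigma> n)\<^sup>2 * K\<^sup>2 / \<epsilon>)"
        using young[of "D n"] young[of "D (Suc n)"] by (simp add: distrib_left)
      also have "\<dots> = \<sigma> n * (2 * \<eta> + \<sigma> n * M)"
        by (simp add: M_def power2_eq_square algebra_simps)
      also have "\<dots> \<le> \<sigma> n * (3 * \<eta>)"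
        using N'[of n] n \<sigma>01[OF n1(1)] by (intro mult_left_mono) auto
      also have "\<dots> = s n * (3 * \<eta> / \<nu>)" using \<nu> by (simp add: s_def)
      finally show ?thesis using step[OF n1(2)] by simp
    qed
    have div: "filterlim (\<lambda>n. \<Sum>i=1..n. s i) at_top sequentially"
      unfolding s_def sum_distrib_right[symmetric]
      using filterlim_tendsto_pos_mult_at_top[OF tendsto_const[of \<nu>] \<nu>(1) \<sigma>_sum] by (simp add: mult.commute)
    have "eventually (\<lambda>n. \<Phi> n < 3 * \<eta> / \<nu> + \<tau> / 2) sequentially"
      using N s01 \<tau>
      by (intro perturbed_contraction_eventually_less[where N = "max N N'", OF _ div rec])
         (auto simp: less_imp_le)
    moreover have "3 * \<eta> / \<nu> + \<tau> / 2 = \<tau>" using \<nu> by (simp add: \<eta>_def)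
    ultimately show ?thesis by simp
  qed

  \<comment> \<open>Norm convergence of the iterates\<close>
  have "w \<longlonglongrightarrow> \<omega>"
    unfolding tendsto_iff
  proof (intro allI impI)
    fix e :: real assume e: "e > 0"
    have "eventually (\<lambda>n. \<Phi> n < e\<^sup>2 / 2) sequentially" using e by (intro small) simp
    then show "eventually (\<lambda>n. dist (w n) \<omega> < e) sequentially"
      using eventually_ge_at_top[of N]
    proof eventually_elim
      case (elim n)
      have "(norm (w n - \<omega>))\<^sup>2 < e\<^sup>2" using elim(1) lower[OF elim(2)] by simp
      then show ?case unfolding dist_norm by (rule power2_less_imp_less) (use e in simp)
    qed
  qed
  then show ?thesis
    using \<omega> \<omega>_unique unfolding Z_def by metis
qed

end
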